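(* With $\mathbb{P}$-probability $1$, the L\'evy area $\mathcal{A}_{0,1}(\mathcal{T}^B)$, defined on the dyadic open upper triangle $\{(s,t)\in D([0,1]^2):0\le s<t\le1\}$, has a unique uniformly continuous extension $\mathcal{A}^*_{0,1}(\mathcal{T}^B)$ to the open upper triangle $\{(s,t)\in[0,1]\times[0,1]:0\le s<t\le1\}$, and hence, by the antisymmetry $\mathcal{A}^*_{0,1}(\mathcal{T}^B)(s,t)=-\mathcal{A}^*_{0,1}(\mathcal{T}^B)(t,s)$, to the open lower triangle $\{(s,t)\in[0,1]\times[0,1]:0\le t<s\le1\}$. $\mathcal{A}^*_{0,1}(\mathcal{T}^B)$ agrees with $\mathcal{A}_{0,1}(\mathcal{T}^B)$ on the dyadic open upper triangle (and on the dyadic open lower triangle) on a set $\Omega_0$ of full $\mathbb{P}$-measure. Moreover, $\mathcal{A}^*_{0,1}(\mathcal{T}^B)$ has a jump discontinuity on the diagonal, and so it does not exist in the injective tensor algebra $C([0,1])\otimes_\vee C([0,1])\cong C([0,1]\times[0,1])$: there does not exist a continuous extension of $\mathcal{A}_{0,1}(\mathcal{T}^B)$ to the unit square $[0,1]\times[0,1]$.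
   Context: $C_0([-1,1])$ is the space of continuous $f:[-1,1]\to\mathbb{R}$ with $f(-1)=0$, with $\mathbb{P}$ Wiener measure on its completed Borel $\sigma$-algebra, under which $B_t(f)=f(t)$, $t\in[-1,1]$, is a Brownian motion started from $0$ at time $-1$. For $h\in[0,1]$, $\mathcal{T}^B_h\in C([0,1])$ is given by $\mathcal{T}^B_h(u)=B_{h-1+u}$, $u\in[0,1]$. $D([0,1]^2)$ is the set of points of $[0,1]^2$ with dyadic rational coordinates. Let $\mathcal{T}^B(n)$ be the dyadic polygonal (piecewise linear in $h$) approximation of $h\mapsto\mathcal{T}^B_h$ at the points $k2^{-n}$. For $(s,t)\in[0,1]^2$ its L\'evy area is $$\mathcal{A}_{0,1}(\mathcal{T}^B(n))(s,t)=\tfrac12\sum_{v=1}^{2^n-1}\Big[\big(\mathcal{T}^B_{\frac{v}{2^n}}(s)-\mathcal{T}^B_0(s)\big)\big(\mathcal{T}^B_{\frac{v+1}{2^n}}(t)-\mathcal{T}^B_{\frac v{2^n}}(t)\big)-\big(\mathcal{T}^B_{\frac{v}{2^n}}(t)-\mathcal{T}^B_0(t)\big)\big(\mathcal{T}^B_{\frac{v+1}{2^n}}(s)-\mathcal{T}^B_{\frac v{2^n}}(s)\big)\Big].$$ For $(s,t)\in D([0,1]^2)$ the limit $\mathcal{A}_{0,1}(\mathcal{T}^B)(s,t):=\lim_{n\to\infty}\mathcal{A}_{0,1}(\mathcal{T}^B(n))(s,t)$ exists $\mathbb{P}$-a.s. It is antisymmetric, vanishes for $s=t$, and for $s<t$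 it is a.s. equal to $$\tfrac12\int_{t-1}^{t}B_{v-(t-s)}dB_v-\tfrac12\int_{t-1}^{s}B_vdB_v+\tfrac12B_{t-1}(B_s-B_{t-1})-\tfrac12B_{s-1}(B_t-B_{t-1})-\tfrac12(1-t+s)+\tfrac12\int_{1-s}^{2-s}\hat B_{v-(t-s)}d\hat B_v-\tfrac12\int_{1-s}^{2-t}\hat B_vd\hat B_v-\tfrac12\hat B_{2-t}(\hat B_{2-s}-\hat B_{2-t})$$ (It\^o integrals), where $\hat B_u:=B_1-B_{1-u}$, $u\in[0,2]$. "Jump discontinuity on the diagonal" means that, at points of the diagonal, the limits of $\mathcal{A}^*_{0,1}(\mathcal{T}^B)$ from the upper and from the lower open triangle exist but are different. The injective tensor product $V\otimes_\vee V$ of a Banach space $V$ is the closure of the algebraic tensor product $V\otimes V$, viewed as the finite rank operators $x^*\mapsto\sum_i x^*(x_i)y_i$, in the space of bounded operators $\mathcal{B}(V^*,V)$; for $V=(C([0,1]),\|\cdot\|_\infty)$ it is identified with $C([0,1]\times[0,1])$ via $(f\otimes g)(s,t)=f(s)g(t)$. *)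

theory Defs
  imports "HOL-Probability.Probability"
begin

section \<open>Wiener measure on the path space\<close>

definition brownian_motion :: "'a measure \<Rightarrow> real \<Rightarrow> real \<Rightarrow> (real \<Rightarrow> 'a \<Rightarrow> real) \<Rightarrow> bool" where
  "brownian_motion M a b B \<longleftrightarrow>
     prob_space M \<and>
     (\<forall>t\<in>{a..b}. B t \<in> borel_measurable M) \<and>
     (AE \<omega> in M. B a \<omega> = 0) \<and>
     (AE \<omega> in M. continuous_on {a..b} (\<lambda>t. B t \<omega>)) \<and>
     (\<forall>s t. a \<le> s \<and> s < t \<and> t \<le> b \<longrightarrow>
        distributed M lborel (\<lambda>\<omega>. B t \<omega> - B s \<omega>) (normal_density 0 (sqrt (t - s)))) \<and>
     (\<forall>(n :: nat) (\<tau> :: nat \<Rightarrow> real).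
        a \<le> \<tau> 0 \<and> (\<forall>i<n. \<tau> i < \<tau> (Suc i)) \<and> \<tau> n \<le> b \<longrightarrow>
        prob_space.indep_vars M (\<lambda>_. borel) (\<lambda>i \<omega>. B (\<tau> (Suc i)) \<omega> - B (\<tau> i) \<omega>) {..<n})"

text \<open>The elements of \<^const>\<open>cfunspace\<close> are extensional, that is, they take the value
  \<^const>\<open>undefined\<close> outside \<open>[-1, 1]\<close>; the metric is the supremum metric.\<close>

definition path_space :: "(real \<Rightarrow> real) metric" where
  "path_space = submetric (cfunspace (top_of_set {-1..1}) euclidean_metric) {f. f (-1) = 0}"

definition path_borel :: "(real \<Rightarrow> real) measure" where
  "path_borel = sigma (mspace path_space) {U. openin (mtopology_of path_space) U}"

definition wiener_measure :: "(real \<Rightarrow> real) measure \<Rightarrow> bool" where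
  "wiener_measure W \<longleftrightarrow>
     sets W = sets path_borel \<and> brownian_motion W (-1) 1 (\<lambda>t f. f t)"

section \<open>The path-valued process and its Levy area\<close>

definition segment_process :: "(real \<Rightarrow> real) \<Rightarrow> real \<Rightarrow> real \<Rightarrow> real" where
  "segment_process f h u = f (h - 1 + u)"

text \<open>The Levy area over \<open>[0, 1]\<close> of the polygonal interpolation of \<open>h \<mapsto> X h\<close> at the points
  \<open>k / 2 ^ n\<close>, evaluated at \<open>(s, t)\<close>; the summand for \<open>v = 0\<close> vanishes.\<close>

definition polygonal_levy_area :: "(real \<Rightarrow> real \<Rightarrow> real) \<Rightarrow> nat \<Rightarrow> real \<times> real \<Rightarrow> real" where
  "polygonal_levy_area X n = (\<lambda>(s, t). 1 / 2 * (\<Sum>v = 1..2 ^ n - 1.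
     (X (real v / 2 ^ n) s - X 0 s) * (X (real (v + 1) / 2 ^ n) t - X (real v / 2 ^ n) t)
     - (X (real v / 2 ^ n) t - X 0 t) * (X (real (v + 1) / 2 ^ n) s - X (real v / 2 ^ n) s)))"

definition levy_area :: "(real \<Rightarrow> real \<Rightarrow> real) \<Rightarrow> real \<times> real \<Rightarrow> real" where
  "levy_area X p = lim (\<lambda>n. polygonal_levy_area X n p)"

definition dyadic_square :: "(real \<times> real) set" where
  "dyadic_square = (dyadics \<inter> {0..1}) \<times> (dyadics \<inter> {0..1})"

definition upper_triangle :: "(real \<times> real) set" where
  "upper_triangle = {(s, t). 0 \<le> s \<and> s < t \<and> t \<le> 1}"

definition lower_triangle :: "(real \<times> real) set" where
  "lower_triangle = {(s, t). 0 \<le> t \<and> t < s \<and> s \<le> 1}"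

definition uniformly_continuous_extension ::
    "('a::metric_space) set \<Rightarrow> 'a set \<Rightarrow> ('a \<Rightarrow> 'b::metric_space) \<Rightarrow> ('a \<Rightarrow> 'b) \<Rightarrow> bool" where
  "uniformly_continuous_extension D U a g \<longleftrightarrow>
     uniformly_continuous_on U g \<and> (\<forall>p\<in>D. g p = a p)"

definition jump_on_diagonal :: "(real \<times> real \<Rightarrow> real) \<Rightarrow> bool" where
  "jump_on_diagonal F \<longleftrightarrow> (\<forall>r\<in>{0..1}. \<exists>u l.
     (F \<longlongrightarrow> u) (at (r, r) within upper_triangle) \<and>
     (F \<longlongrightarrow> l) (at (r, r) within lower_triangle) \<and> u \<noteq> l)"

section \<open>The injective tensor product\<close>

lift_definition rank_one :: "'v::real_normed_vector \<Rightarrow> 'v \<Rightarrow> ('v \<Rightarrow>\<^sub>L real) \<Rightarrow>\<^sub>L 'v"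
  is "\<lambda>x y \<phi>. blinfun_apply \<phi> x *\<^sub>R y"
  by (intro bounded_linear_intros)

definition injective_tensor_product :: "(('v::real_normed_vector \<Rightarrow>\<^sub>L real) \<Rightarrow>\<^sub>L 'v) set" where
  "injective_tensor_product = closure (span {rank_one x y | x y. True})"

typedef unit_interval = "{0..1 :: real}"
  morphisms real_of_unit unit_of_real
  by (rule exI[of _ 0]) simp

instantiation unit_interval :: metric_space
begin

definition dist_unit_interval :: "unit_interval \<Rightarrow> unit_interval \<Rightarrow> real" where
  "dist_unit_interval x y = dist (real_of_unit x) (real_of_unit y)"

definition uniformity_unit_interval :: "(unit_interval \<times> unit_interval) filter" where
  "uniformity_unit_interval = (INF e\<in>{0<..}. principal {(x, y). dist x y < e})"

definition open_unit_interval :: "unit_interval set \<Rightarrow> bool" where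
  "open_unit_interval U \<longleftrightarrow>
     (\<forall>x\<in>U. eventually (\<lambda>(x', y). x' = x \<longrightarrow> y \<in> U) uniformity)"

instance
proof
  fix x y z :: unit_interval
  show "dist x y = 0 \<longleftrightarrow> x = y"
    by (simp add: dist_unit_interval_def real_of_unit_inject)
  show "dist x y \<le> dist x z + dist y z"
    unfolding dist_unit_interval_def by (rule dist_triangle2)
qed (simp_all add: uniformity_unit_interval_def open_unit_interval_def)

end

text \<open>As the unit interval is compact, \<open>unit_interval \<Rightarrow>\<^sub>C real\<close> is the Banach space of all
  continuous functions on it, with the supremum norm.\<close>

lift_definition eval_functional :: "'a::topological_space \<Rightarrow> ('a \<Rightarrow>\<^sub>C real) \<Rightarrow>\<^sub>L real"
  is "\<lambda>x f. apply_bcontfun f x"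
proof (rule bounded_linear_intro[where K = 1])
  fix x :: 'a and f g :: "'a \<Rightarrow>\<^sub>C real" and r :: real
  show "apply_bcontfun (f + g) x = apply_bcontfun f x + apply_bcontfun g x"
    by (simp add: plus_bcontfun.rep_eq)
  show "apply_bcontfun (r *\<^sub>R f) x = r *\<^sub>R apply_bcontfun f x"
    by (simp add: scaleR_bcontfun.rep_eq)
  show "norm (apply_bcontfun f x) \<le> norm f * 1"
    using norm_bounded[of f x] by simp
qed

text \<open>The identification of the injective tensor product of \<open>C([0,1])\<close> with itself and
  \<open>C([0,1] \<times> [0,1])\<close>: an operator is mapped to its kernel, so that \<open>f \<otimes> g\<close> becomes
  \<open>(s, t) \<mapsto> f s * g t\<close>.\<close>

definition tensor_kernel ::
    "((unit_interval \<Rightarrow>\<^sub>C real) \<Rightarrow>\<^sub>L real) \<Rightarrow>\<^sub>L (unit_interval \<Rightarrow>\<^sub>C real) \<Rightarrow> real \<times> real \<Rightarrow> real" where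
  "tensor_kernel \<Phi> = (\<lambda>(s, t).
     apply_bcontfun (blinfun_apply \<Phi> (eval_functional (unit_of_real s))) (unit_of_real t))"

lemma tensor_kernel_rank_one:
  "tensor_kernel (rank_one f g) (s, t) =
     apply_bcontfun f (unit_of_real s) * apply_bcontfun g (unit_of_real t)"
  by (simp add: tensor_kernel_def rank_one.rep_eq eval_functional.rep_eq scaleR_bcontfun.rep_eq)

end

theory Submission
  imports Defs "HOL-Real_Asymp.Real_Asymp"
begin

text \<open>
  Fix a path \<open>f\<close> and write \<open>a v = f (s - 1 + v / 2 ^ n)\<close> and \<open>b v = f (t - 1 + v / 2 ^ n)\<close>. Summation
  by parts turns the polygonal Levy area at \<open>(s, t)\<close> into three parts: the Ito sum of the terms
  \<open>a v * (b (v + 1) - b v)\<close>, half the sum of the products of the simultaneous increments of \<open>a\<close>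
  and \<open>b\<close>, and a boundary term that is continuous in \<open>(s, t)\<close>.

  For almost every path the Ito sums converge uniformly on the closed triangle \<open>0 \<le> s \<le> t \<le> 1\<close>, so
  their limit is continuous there, and uniformly so by compactness. The sums of products of increments
  do not behave like this: at dyadic points with \<open>s < t\<close> they tend to \<open>0\<close>, but for \<open>s = t\<close> they are the
  quadratic variation and tend to \<open>1\<close>. Hence on the dyadic upper triangle the area agrees with a
  function that is continuous on the closed triangle. This function equals \<open>- 1 / 2\<close> on the
  diagonal, because for \<open>s = t\<close> the polygonal area is \<open>0\<close> and includes the additional \<open>1 / 2\<close>. By
  antisymmetry the limit from the lower triangle is \<open>1 / 2\<close>, which is the jump.

  The uniform convergence (\<open>AE_lagged_sum_refinement\<close>, \<open>refinement_bound\<close>) rests on adaptedness.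
  Halving the mesh changes the Ito sum by a sum of products of increments in which, as \<open>s \<le> t\<close>, the
  factor taken from the \<open>s\<close>-path is determined before the factor from the \<open>t\<close>-path begins. Such a
  sum is a Gaussian martingale. Its exponential martingale shows that it
  exceeds \<open>\<epsilon>\<close>, while all first factors are at most \<open>b\<close>, with probability at most
  \<open>2 * exp (- \<epsilon>\<^sup>2 / (4 * b\<^sup>2))\<close>. By the Hoelder continuity of the path, \<open>b\<close> decays exponentially
  in \<open>n\<close>, so an exponentially small \<open>\<epsilon>\<close> already makes these probabilities small enough for a union
  bound over an exponentially large grid of pairs \<open>(s, t)\<close>. The
  Hoelder continuity also covers the pairs between the grid points. The same tail bound makes the
  products of simultaneous increments vanish for \<open>s < t\<close>.

  An element of the injective tensor product is a norm limit of finite rank operators, whose kernels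
  are continuous on the square; the norm dominates the supremum of the kernel, so the kernel of
  the limit is continuous as well and cannot have the jump.
\<close>

section \<open>Gaussian martingales\<close>

text \<open>Multiplying a centred normal density by this exponential only moves its mean to
  \<open>\<sigma>\<^sup>2 * c\<close>, so the total mass stays \<open>1\<close>.\<close>

lemma nn_integral_normal_tilt:
  fixes c \<sigma> :: real
  assumes "0 < \<sigma>"
  shows "(\<integral>\<^sup>+ x. ennreal (normal_density 0 \<sigma> x) * ennreal (exp (c * x - \<sigma>\<^sup>2 / 2 * c\<^sup>2)) \<partial>lborel) = 1"
proof -
  have tilt: "normal_density 0 \<sigma> x * exp (c * x - \<sigma>\<^sup>2 / 2 * c\<^sup>2) = normal_density (\<sigma>\<^sup>2 * c) \<sigma> x" for x
  proof -
    have "- (x - 0)\<^sup>2 / (2 * \<sigma>\<^sup>2) + (c * x - \<sigma>\<^sup>2 / 2 * c\<^sup>2) = - (x - \<sigma>\<^sup>2 * c)\<^sup>2 / (2 * \<sigma>\<^sup>2)"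
      using assms by (simp add: field_simps power2_eq_square)
    then show ?thesis
      unfolding normal_density_def by (simp add: mult.assoc flip: exp_add)
  qed
  have "(\<integral>\<^sup>+ x. ennreal (normal_density 0 \<sigma> x) * ennreal (exp (c * x - \<sigma>\<^sup>2 / 2 * c\<^sup>2)) \<partial>lborel)
      = (\<integral>\<^sup>+ x. ennreal (normal_density (\<sigma>\<^sup>2 * c) \<sigma> x) \<partial>lborel)"
    by (simp only: tilt[symmetric] ennreal_mult[OF normal_density_nonneg exp_ge_zero])
  also have "\<dots> = 1"
    using assms by (simp add: nn_integral_eq_integral)
  finally show ?thesis .
qed

context prob_space
begin

lemma indep_var_of_indep_vars:
  assumes "indep_vars (\<lambda>_. borel) Z A" and ij: "i \<in> A" "j \<in> A" "i \<noteq> j"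
  shows "indep_var borel (Z i :: 'a \<Rightarrow> real) borel (Z j)"
proof -
  have "indep_var borel ((\<lambda>x. x i) \<circ> (\<lambda>\<omega>. restrict (\<lambda>k. Z k \<omega>) {i})) borel ((\<lambda>x. x j) \<circ> (\<lambda>\<omega>. restrict (\<lambda>k. Z k \<omega>) {j}))"
    using ij by (intro indep_var_compose[OF indep_var_restrict[OF assms(1)]]) auto
  then show ?thesis
    by (simp add: comp_def)
qed

text \<open>Given the past, the newest factor has expectation \<open>1\<close> because its weight is then a constant;
  integrating the factors out one by one, starting with the last, proves the claim. The weights
  \<open>w i\<close> are functions of the restricted sequence of increments, which makes it visible that
  they only depend on the past of step \<open>i\<close>.\<close>

lemma exponential_martingale:
  fixes e :: "nat \<Rightarrow> 'a \<Rightarrow> real" and w :: "nat \<Rightarrow> (nat \<Rightarrow> real) \<Rightarrow> real"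
  assumes indep: "indep_vars (\<lambda>_. borel) e {..<n}"
    and normal: "\<And>i. i < n \<Longrightarrow> distributed M lborel (e i) (normal_density 0 \<sigma>)"
    and \<sigma>: "0 < \<sigma>"
    and w: "\<And>i. i < n \<Longrightarrow> w i \<in> borel_measurable (PiM {..<i} (\<lambda>_. borel))"
  shows "(\<integral>\<^sup>+ \<omega>. ennreal (exp (\<Sum>i<n. w i (restrict (\<lambda>j. e j \<omega>) {..<i}) * e i \<omega>
            - \<sigma>\<^sup>2 / 2 * (w i (restrict (\<lambda>j. e j \<omega>) {..<i}))\<^sup>2)) \<partial>M) = 1"
  using assms
proof (induction n)
  case 0
  then show ?case by (simp add: emeasure_space_1)
next
  case (Suc n)
  define past where "past = (\<lambda>\<omega>. restrict (\<lambda>j. e j \<omega>) {..<n})"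
  \<comment> \<open>independence is a relation between variables of one type, so the last increment is kept as a function on \<open>{n}\<close>\<close>
  define step where "step = (\<lambda>\<omega>. restrict (\<lambda>j. e j \<omega>) {n})"
  define F where "F = (\<lambda>x. \<Sum>i<n. w i (restrict x {..<i}) * x i - \<sigma>\<^sup>2 / 2 * (w i (restrict x {..<i}))\<^sup>2)"
  let ?P = "PiM {..<n} (\<lambda>_. borel :: real measure)"
  let ?Q = "PiM {n} (\<lambda>_. borel :: real measure)"
  have [measurable]: "(\<lambda>y. y n) \<in> borel_measurable ?Q"
    by (intro measurable_component_singleton) auto
  have [measurable]: "w n \<in> borel_measurable ?P"
    using Suc.prems by simp
  have [measurable]: "F \<in> borel_measurable ?P"
    unfolding F_def
  proof (intro borel_measurable_sum)
    fix i assume i: "i \<in> {..<n}"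
    have *[measurable]: "(\<lambda>x. w i (restrict x {..<i})) \<in> borel_measurable ?P"
      using i by (intro measurable_compose[OF measurable_restrict_subset Suc.prems(4)]) auto
    have [measurable]: "(\<lambda>x. x i) \<in> borel_measurable ?P"
      using i by (intro measurable_component_singleton) auto
    show "(\<lambda>x. w i (restrict x {..<i}) * x i - \<sigma>\<^sup>2 / 2 * (w i (restrict x {..<i}))\<^sup>2) \<in> borel_measurable ?P"
      by measurable
  qed
  have indep_n: "indep_vars (\<lambda>_. borel) e {..<n}"
    by (rule indep_vars_subset[OF Suc.prems(1)]) auto
  have "indep_var ?P (\<lambda>\<omega>. restrict (\<lambda>i. e i \<omega>) {..<n}) (PiM {n} (\<lambda>_. borel)) (\<lambda>\<omega>. restrict (\<lambda>i. e i \<omega>) {n})"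
    by (rule indep_var_restrict[OF Suc.prems(1)]) auto
  then have iv: "indep_var ?P past ?Q step"
    by (simp add: past_def step_def)
  then have [measurable]: "random_variable ?P past" "random_variable ?Q step"
    and joint: "distr M ?P past \<Otimes>\<^sub>M distr M ?Q step = distr M (?P \<Otimes>\<^sub>M ?Q) (\<lambda>\<omega>. (past \<omega>, step \<omega>))"
    unfolding indep_var_distribution_eq by auto
  interpret future: prob_space "distr M ?Q step"
    by (rule prob_space_distr) simp
  have future_one: "(\<integral>\<^sup>+ y. ennreal (exp (c * y n - \<sigma>\<^sup>2 / 2 * c\<^sup>2)) \<partial>distr M ?Q step) = 1" for c
  proof -
    have "(\<integral>\<^sup>+ y. ennreal (exp (c * y n - \<sigma>\<^sup>2 / 2 * c\<^sup>2)) \<partial>distr M ?Q step)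
        = (\<integral>\<^sup>+ \<omega>. ennreal (exp (c * e n \<omega> - \<sigma>\<^sup>2 / 2 * c\<^sup>2)) \<partial>M)"
      by (subst nn_integral_distr) (simp_all, simp add: step_def)
    also have "\<dots> = (\<integral>\<^sup>+ x. ennreal (normal_density 0 \<sigma> x) * ennreal (exp (c * x - \<sigma>\<^sup>2 / 2 * c\<^sup>2)) \<partial>lborel)"
      using Suc.prems(2)[of n] by (subst distributed_nn_integral) auto
    finally show ?thesis
      by (simp only: nn_integral_normal_tilt[OF Suc.prems(3)])
  qed
  have restr: "restrict (past \<omega>) {..<i} = restrict (\<lambda>j. e j \<omega>) {..<i}" if "i < n" for i \<omega>
    using that by (auto simp: past_def fun_eq_iff)
  have F_past: "F (past \<omega>) = (\<Sum>i<n. w i (restrict (\<lambda>j. e j \<omega>) {..<i}) * e i \<omega>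
            - \<sigma>\<^sup>2 / 2 * (w i (restrict (\<lambda>j. e j \<omega>) {..<i}))\<^sup>2)" for \<omega>
    unfolding F_def by (intro sum.cong refl) (simp add: restr, simp add: past_def)
  let ?G = "\<lambda>(x, y). ennreal (exp (F x)) * ennreal (exp (w n x * y n - \<sigma>\<^sup>2 / 2 * (w n x)\<^sup>2))"
  have "(\<integral>\<^sup>+ \<omega>. ennreal (exp (\<Sum>i<Suc n. w i (restrict (\<lambda>j. e j \<omega>) {..<i}) * e i \<omega>
            - \<sigma>\<^sup>2 / 2 * (w i (restrict (\<lambda>j. e j \<omega>) {..<i}))\<^sup>2)) \<partial>M)
      = (\<integral>\<^sup>+ \<omega>. ?G (past \<omega>, step \<omega>) \<partial>M)"
    by (simp add: F_past flip: ennreal_mult' exp_add) (simp add: past_def step_def)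
  also have "\<dots> = (\<integral>\<^sup>+ z. ?G z \<partial>(distr M (?P \<Otimes>\<^sub>M ?Q) (\<lambda>\<omega>. (past \<omega>, step \<omega>))))"
    by (subst nn_integral_distr) auto
  also have "\<dots> = (\<integral>\<^sup>+ x. \<integral>\<^sup>+ y. ?G (x, y) \<partial>distr M ?Q step \<partial>distr M ?P past)"
    unfolding joint[symmetric] by (subst future.nn_integral_fst) auto
  also have "\<dots> = (\<integral>\<^sup>+ x. ennreal (exp (F x)) \<partial>distr M ?P past)"
  proof (intro nn_integral_cong)
    fix x
    show "(\<integral>\<^sup>+ y. ?G (x, y) \<partial>distr M ?Q step) = ennreal (exp (F x))"
      unfolding prod.case by (subst nn_integral_cmult, measurable) (simp only: future_one mult_1_right)
  qed
  also have "\<dots> = (\<integral>\<^sup>+ \<omega>. ennreal (exp (F (past \<omega>))) \<partial>M)"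
    by (subst nn_integral_distr) auto
  also have "\<dots> = 1"
    unfolding F_past by (rule Suc.IH) (use indep_n Suc.prems in auto)
  finally show ?case .
qed

text \<open>A Gaussian tail bound for martingales whose quadratic variation is controlled only on part of
  the probability space: the bound on the quadratic variation is put into the event.\<close>

lemma gaussian_martingale_upper_tail:
  fixes e :: "nat \<Rightarrow> 'a \<Rightarrow> real" and w :: "nat \<Rightarrow> (nat \<Rightarrow> real) \<Rightarrow> real"
  assumes indep: "indep_vars (\<lambda>_. borel) e {..<n}"
    and normal: "\<And>i. i < n \<Longrightarrow> distributed M lborel (e i) (normal_density 0 \<sigma>)"
    and \<sigma>: "0 < \<sigma>"
    and w: "\<And>i. i < n \<Longrightarrow> w i \<in> borel_measurable (PiM {..<i} (\<lambda>_. borel))"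
    and W: "\<And>i. i < n \<Longrightarrow> (\<lambda>\<omega>. w i (restrict (\<lambda>j. e j \<omega>) {..<i})) = W i"
    and pos: "0 < \<epsilon>" "0 < V"
  shows "prob {\<omega> \<in> space M. \<epsilon> \<le> (\<Sum>i<n. W i \<omega> * e i \<omega>) \<and> \<sigma>\<^sup>2 * (\<Sum>i<n. (W i \<omega>)\<^sup>2) \<le> V}
    \<le> exp (- \<epsilon>\<^sup>2 / (2 * V))"
proof -
  have [measurable]: "random_variable borel (e i)" if "i < n" for i
    using indep that by (auto simp: indep_vars_def)
  have [measurable]: "random_variable borel (W i)" if "i < n" for i
  proof -
    have "(\<lambda>\<omega>. restrict (\<lambda>j. e j \<omega>) {..<i}) \<in> measurable M (PiM {..<i} (\<lambda>_. borel))"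
      using that by (intro measurable_restrict) auto
    from measurable_compose[OF this w[OF that]] show ?thesis
      unfolding W[OF that, symmetric] .
  qed
  \<comment> \<open>this value minimizes \<open>lam\<^sup>2 / 2 * V - lam * \<epsilon>\<close>\<close>
  define lam where "lam = \<epsilon> / V"
  define Z where "Z = (\<lambda>\<omega>. \<Sum>i<n. lam * W i \<omega> * e i \<omega> - \<sigma>\<^sup>2 / 2 * (lam * W i \<omega>)\<^sup>2)"
  have [measurable]: "random_variable borel Z"
    unfolding Z_def by (intro borel_measurable_sum) auto
  have Z_eq: "Z \<omega> = lam * (\<Sum>i<n. W i \<omega> * e i \<omega>) - lam\<^sup>2 / 2 * (\<sigma>\<^sup>2 * (\<Sum>i<n. (W i \<omega>)\<^sup>2))" for \<omega>
    unfolding Z_def by (simp add: sum_subtractf sum_distrib_left power_mult_distrib mult_ac)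
  have one: "(\<integral>\<^sup>+ \<omega>. ennreal (exp (Z \<omega>)) \<partial>M) = 1"
  proof -
    have "(\<integral>\<^sup>+ \<omega>. ennreal (exp (\<Sum>i<n. (\<lambda>i x. lam * w i x) i (restrict (\<lambda>j. e j \<omega>) {..<i}) * e i \<omega>
            - \<sigma>\<^sup>2 / 2 * ((\<lambda>i x. lam * w i x) i (restrict (\<lambda>j. e j \<omega>) {..<i}))\<^sup>2)) \<partial>M) = 1"
      by (rule exponential_martingale[OF indep normal \<sigma>]) (auto intro!: borel_measurable_times w)
    then show ?thesis
      unfolding Z_def by (simp add: W[symmetric])
  qed
  have lower: "\<epsilon>\<^sup>2 / (2 * V) \<le> Z \<omega>"
    if "\<epsilon> \<le> (\<Sum>i<n. W i \<omega> * e i \<omega>)" "\<sigma>\<^sup>2 * (\<Sum>i<n. (W i \<omega>)\<^sup>2) \<le> V" for \<omega>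
  proof -
    have "lam * \<epsilon> - lam\<^sup>2 / 2 * V \<le> Z \<omega>"
      unfolding Z_eq using that pos by (intro diff_mono mult_left_mono) (auto simp: lam_def)
    moreover have "lam * \<epsilon> - lam\<^sup>2 / 2 * V = \<epsilon>\<^sup>2 / (2 * V)"
      using pos by (simp add: lam_def field_simps power2_eq_square)
    ultimately show ?thesis by simp
  qed
  let ?A = "{\<omega> \<in> space M. \<epsilon> \<le> (\<Sum>i<n. W i \<omega> * e i \<omega>) \<and> \<sigma>\<^sup>2 * (\<Sum>i<n. (W i \<omega>)\<^sup>2) \<le> V}"
  have [measurable]: "?A \<in> sets M"
  proof -
    have [measurable]: "random_variable borel (\<lambda>\<omega>. \<Sum>i<n. W i \<omega> * e i \<omega>)"
      "random_variable borel (\<lambda>\<omega>. \<Sum>i<n. (W i \<omega>)\<^sup>2)"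
      by (intro borel_measurable_sum; simp)+
    show ?thesis by measurable
  qed
  have "emeasure M ?A = (\<integral>\<^sup>+ \<omega>. indicator ?A \<omega> \<partial>M)"
    by simp
  also have "\<dots> \<le> (\<integral>\<^sup>+ \<omega>. ennreal (exp (- \<epsilon>\<^sup>2 / (2 * V))) * ennreal (exp (Z \<omega>)) \<partial>M)"
  proof (intro nn_integral_mono)
    fix \<omega>
    show "indicator ?A \<omega> \<le> ennreal (exp (- \<epsilon>\<^sup>2 / (2 * V))) * ennreal (exp (Z \<omega>))"
    proof (cases "\<omega> \<in> ?A")
      case True
      then have "1 \<le> exp (- \<epsilon>\<^sup>2 / (2 * V) + Z \<omega>)"
        using lower[of \<omega>] by simp
      then have "1 \<le> ennreal (exp (- \<epsilon>\<^sup>2 / (2 * V) + Z \<omega>))"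
        using ennreal_leI by fastforce
      then show ?thesis
        using True by (simp only: exp_add ennreal_mult[OF exp_ge_zero exp_ge_zero] indicator_simps)
    qed simp
  qed
  also have "\<dots> = ennreal (exp (- \<epsilon>\<^sup>2 / (2 * V)))"
    by (subst nn_integral_cmult) (auto simp: one)
  finally show ?thesis
    by (simp add: emeasure_eq_measure)
qed

lemma gaussian_martingale_tail:
  fixes e :: "nat \<Rightarrow> 'a \<Rightarrow> real" and w :: "nat \<Rightarrow> (nat \<Rightarrow> real) \<Rightarrow> real"
  assumes indep: "indep_vars (\<lambda>_. borel) e {..<n}"
    and normal: "\<And>i. i < n \<Longrightarrow> distributed M lborel (e i) (normal_density 0 \<sigma>)"
    and \<sigma>: "0 < \<sigma>"
    and w: "\<And>i. i < n \<Longrightarrow> w i \<in> borel_measurable (PiM {..<i} (\<lambda>_. borel))"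
    and W: "\<And>i. i < n \<Longrightarrow> (\<lambda>\<omega>. w i (restrict (\<lambda>j. e j \<omega>) {..<i})) = W i"
    and pos: "0 < \<epsilon>" "0 < V"
  shows "{\<omega> \<in> space M. \<epsilon> \<le> \<bar>\<Sum>i<n. W i \<omega> * e i \<omega>\<bar> \<and> \<sigma>\<^sup>2 * (\<Sum>i<n. (W i \<omega>)\<^sup>2) \<le> V} \<in> events"
      (is "?A \<in> events")
    and "prob {\<omega> \<in> space M. \<epsilon> \<le> \<bar>\<Sum>i<n. W i \<omega> * e i \<omega>\<bar> \<and> \<sigma>\<^sup>2 * (\<Sum>i<n. (W i \<omega>)\<^sup>2) \<le> V}
      \<le> 2 * exp (- \<epsilon>\<^sup>2 / (2 * V))"
proof -
  let ?U = "\<lambda>W. {\<omega> \<in> space M. \<epsilon> \<le> (\<Sum>i<n. W i \<omega> * e i \<omega>) \<and> \<sigma>\<^sup>2 * (\<Sum>i<n. (W i \<omega>)\<^sup>2) \<le> V}"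
  have [measurable]: "random_variable borel (e i)" if "i < n" for i
    using indep that by (auto simp: indep_vars_def)
  have [measurable]: "random_variable borel (W i)" if "i < n" for i
  proof -
    have "(\<lambda>\<omega>. restrict (\<lambda>j. e j \<omega>) {..<i}) \<in> measurable M (PiM {..<i} (\<lambda>_. borel))"
      using that by (intro measurable_restrict) auto
    from measurable_compose[OF this w[OF that]] show ?thesis
      unfolding W[OF that, symmetric] .
  qed
  have [measurable]: "random_variable borel (\<lambda>\<omega>. \<Sum>i<n. W i \<omega> * e i \<omega>)"
    "random_variable borel (\<lambda>\<omega>. \<Sum>i<n. - W i \<omega> * e i \<omega>)"
    "random_variable borel (\<lambda>\<omega>. \<Sum>i<n. (W i \<omega>)\<^sup>2)"
    by (intro borel_measurable_sum; simp)+
  show "?A \<in> events"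
    by measurable
  have U: "prob (?U W) \<le> exp (- \<epsilon>\<^sup>2 / (2 * V))"
    by (rule gaussian_martingale_upper_tail[OF indep normal \<sigma> w W pos])
  have U': "prob (?U (\<lambda>i \<omega>. - W i \<omega>)) \<le> exp (- \<epsilon>\<^sup>2 / (2 * V))"
    by (rule gaussian_martingale_upper_tail[OF indep normal \<sigma> _ _ pos, of "\<lambda>i x. - w i x"])
       (auto simp: w W[symmetric] intro!: borel_measurable_uminus)
  have "?A = ?U W \<union> ?U (\<lambda>i \<omega>. - W i \<omega>)"
    by (auto simp: sum_negf abs_if split: if_splits)
  then have "prob ?A \<le> prob (?U W) + prob (?U (\<lambda>i \<omega>. - W i \<omega>))"
    by (simp only:) (intro measure_Un_le; measurable)
  also have "\<dots> \<le> exp (- \<epsilon>\<^sup>2 / (2 * V)) + exp (- \<epsilon>\<^sup>2 / (2 * V))"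
    by (rule add_mono[OF U U'])
  finally show "prob ?A \<le> 2 * exp (- \<epsilon>\<^sup>2 / (2 * V))"
    by simp
qed

lemma gaussian_walk_increment_tail:
  fixes X :: "nat \<Rightarrow> 'a \<Rightarrow> real"
  assumes indep: "indep_vars (\<lambda>_. borel) (\<lambda>i \<omega>. X (Suc i) \<omega> - X i \<omega>) {..<n}"
    and normal: "\<And>i. i < n \<Longrightarrow>
      distributed M lborel (\<lambda>\<omega>. X (Suc i) \<omega> - X i \<omega>) (normal_density 0 \<sigma>)"
    and \<sigma>: "0 < \<sigma>" and k: "k < n" and \<epsilon>: "0 < \<epsilon>"
  shows "prob {\<omega> \<in> space M. \<epsilon> \<le> \<bar>X (Suc k) \<omega> - X k \<omega>\<bar>} \<le> 2 * exp (- \<epsilon>\<^sup>2 / (2 * \<sigma>\<^sup>2))"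
proof -
  let ?W = "\<lambda>i. if i = k then 1 else 0 :: real"
  have "prob {\<omega> \<in> space M. \<epsilon> \<le> \<bar>\<Sum>i<n. ?W i * (X (Suc i) \<omega> - X i \<omega>)\<bar> \<and> \<sigma>\<^sup>2 * (\<Sum>i<n. (?W i)\<^sup>2) \<le> \<sigma>\<^sup>2}
      \<le> 2 * exp (- \<epsilon>\<^sup>2 / (2 * \<sigma>\<^sup>2))"
    using \<sigma> by (intro gaussian_martingale_tail(2)[OF indep normal \<sigma> _ _ \<epsilon>, of "\<lambda>i _. ?W i"]) auto
  moreover have "(\<Sum>i<n. ?W i * f i) = f k" for f :: "nat \<Rightarrow> real"
    using k by (simp add: if_distrib[of "\<lambda>x. x * _"] cong: if_cong)
  moreover have "(\<Sum>i<n. (?W i)\<^sup>2) = 1"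
    using k by (simp add: if_distrib[of "\<lambda>x. x\<^sup>2"] cong: if_cong)
  ultimately show ?thesis
    by simp
qed

text \<open>The increment \<open>X (q u) - X (p u)\<close> is known before the block from \<open>T + u * r\<close> to
  \<open>T + Suc u * r\<close> begins. Spread over the steps of its block, it is a previsible weight, and the
  sum is a Gaussian martingale. Its quadratic variation is at most \<open>\<sigma>\<^sup>2 * n * b\<^sup>2\<close> as soon as
  all weights are at most \<open>b\<close>.\<close>

lemma gaussian_walk_bilinear_tail:
  fixes X :: "nat \<Rightarrow> 'a \<Rightarrow> real"
  assumes rv: "\<And>i. i \<le> n \<Longrightarrow> random_variable borel (X i)"
    and indep: "indep_vars (\<lambda>_. borel) (\<lambda>i \<omega>. X (Suc i) \<omega> - X i \<omega>) {..<n}"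
    and normal: "\<And>i. i < n \<Longrightarrow>
      distributed M lborel (\<lambda>\<omega>. X (Suc i) \<omega> - X i \<omega>) (normal_density 0 \<sigma>)"
    and \<sigma>: "0 < \<sigma>"
    and block: "T + K * r \<le> n" "0 < r"
    and past: "\<And>u. u < K \<Longrightarrow> p u \<le> T + u * r" "\<And>u. u < K \<Longrightarrow> q u \<le> T + u * r"
    and pos: "0 < \<epsilon>" "0 < b" "0 < n"
  shows "prob {\<omega> \<in> space M.
      \<epsilon> \<le> \<bar>\<Sum>u<K. (X (q u) \<omega> - X (p u) \<omega>) * (X (T + Suc u * r) \<omega> - X (T + u * r) \<omega>)\<bar> \<and>
      (\<forall>u<K. \<bar>X (q u) \<omega> - X (p u) \<omega>\<bar> \<le> b)} \<le> 2 * exp (- \<epsilon>\<^sup>2 / (2 * (\<sigma>\<^sup>2 * real n * b\<^sup>2)))"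
proof -
  \<comment> \<open>the block that contains step \<open>j\<close>\<close>
  define ind where "ind j = (j - T) div r" for j
  define e where "e i \<omega> = X (Suc i) \<omega> - X i \<omega>" for i \<omega>
  define w where "w j x = (if T \<le> j \<and> j < T + K * r then (\<Sum>i<q (ind j). x i) - (\<Sum>i<p (ind j). x i) else 0)"
    for j and x :: "nat \<Rightarrow> real"
  define W where "W j \<omega> = (if T \<le> j \<and> j < T + K * r then X (q (ind j)) \<omega> - X (p (ind j)) \<omega> else 0)" for j \<omega>
  have ind: "ind j < K" "T + ind j * r \<le> j" if "T \<le> j" "j < T + K * r" for j
  proof -
    show "ind j < K"
      unfolding ind_def using that block by (intro less_mult_imp_div_less) simp
    have "ind j * r \<le> j - T"
      unfolding ind_def by simp
    then show "T + ind j * r \<le> j"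
      using that by simp
  qed
  have ind_past: "q (ind j) \<le> j" "p (ind j) \<le> j" if "T \<le> j" "j < T + K * r" for j
    using ind[OF that] past[of "ind j"] by linarith+
  have w: "w j \<in> borel_measurable (PiM {..<j} (\<lambda>_. borel))" if "j < n" for j
  proof (cases "T \<le> j \<and> j < T + K * r")
    case True
    have sum_meas: "(\<lambda>x. \<Sum>i<m. x i) \<in> borel_measurable (PiM {..<j} (\<lambda>_. borel :: real measure))" if "m \<le> j" for m
      using that by (intro borel_measurable_sum[where f = "\<lambda>i x. x i"] measurable_component_singleton) auto
    have "(\<lambda>x :: nat \<Rightarrow> real. (\<Sum>i<q (ind j). x i) - (\<Sum>i<p (ind j). x i)) \<in> borel_measurable (PiM {..<j} (\<lambda>_. borel))"
      using ind_past[of j] True by (intro borel_measurable_diff sum_meas) auto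
    with True show ?thesis
      unfolding w_def by simp
  next
    case False
    then have "w j = (\<lambda>_. 0)"
      by (auto simp: w_def fun_eq_iff)
    then show ?thesis by simp
  qed
  have W: "(\<lambda>\<omega>. w j (restrict (\<lambda>j. e j \<omega>) {..<j})) = W j" if "j < n" for j
  proof
    fix \<omega>
    have "(\<Sum>i<m. restrict (\<lambda>j. e j \<omega>) {..<j} i) = X m \<omega> - X 0 \<omega>" if "m \<le> j" for m
    proof -
      have "(\<Sum>i<m. restrict (\<lambda>j. e j \<omega>) {..<j} i) = (\<Sum>i<m. X (Suc i) \<omega> - X i \<omega>)"
        using that by (intro sum.cong) (auto simp: e_def)
      also have "\<dots> = X m \<omega> - X 0 \<omega>"
        by (rule sum_lessThan_telescope)
      finally show ?thesis .
    qed
    then show "w j (restrict (\<lambda>j. e j \<omega>) {..<j}) = W j \<omega>"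
      using ind_past[of j] by (auto simp: w_def W_def)
  qed
  have sum_eq: "(\<Sum>j<n. W j \<omega> * e j \<omega>)
      = (\<Sum>u<K. (X (q u) \<omega> - X (p u) \<omega>) * (X (T + Suc u * r) \<omega> - X (T + u * r) \<omega>))" for \<omega>
  proof -
    let ?x = "\<lambda>u. X (q u) \<omega> - X (p u) \<omega>"
    have "(\<Sum>j<n. W j \<omega> * e j \<omega>) = (\<Sum>j\<in>{T..<T + K * r}. W j \<omega> * e j \<omega>)"
      using block by (intro sum.mono_neutral_right) (auto simp: W_def)
    also have "\<dots> = (\<Sum>j\<in>{0..<K * r}. W (j + T) \<omega> * e (j + T) \<omega>)"
      using sum.shift_bounds_nat_ivl[of "\<lambda>j. W j \<omega> * e j \<omega>" 0 T "K * r"] by (simp add: add.commute)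
    also have "\<dots> = (\<Sum>j<K * r. ?x (j div r) * e (j + T) \<omega>)"
      by (intro sum.cong) (auto simp: W_def ind_def)
    also have "\<dots> = (\<Sum>u<K. \<Sum>j = u * r..<u * r + r. ?x (j div r) * e (j + T) \<omega>)"
      by (rule sum.nat_group[symmetric])
    also have "\<dots> = (\<Sum>u<K. ?x u * (X (T + Suc u * r) \<omega> - X (T + u * r) \<omega>))"
    proof (intro sum.cong refl)
      fix u
      have "(\<Sum>j = u * r..<u * r + r. ?x (j div r) * e (j + T) \<omega>) = (\<Sum>j = u * r..<u * r + r. ?x u * e (j + T) \<omega>)"
      proof (intro sum.cong refl)
        fix j assume "j \<in> {u * r..<u * r + r}"
        then have "j div r = u"
          using block(2) by (intro div_nat_eqI) (auto simp: mult.commute)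
        then show "?x (j div r) * e (j + T) \<omega> = ?x u * e (j + T) \<omega>"
          by simp
      qed
      also have "\<dots> = ?x u * (\<Sum>j = u * r..<u * r + r. X (Suc j + T) \<omega> - X (j + T) \<omega>)"
        by (simp add: e_def sum_distrib_left)
      also have "(\<Sum>j = u * r..<u * r + r. X (Suc j + T) \<omega> - X (j + T) \<omega>)
          = X (T + Suc u * r) \<omega> - X (T + u * r) \<omega>"
        by (subst sum_Suc_diff') (simp_all add: algebra_simps)
      finally show "(\<Sum>j = u * r..<u * r + r. ?x (j div r) * e (j + T) \<omega>)
          = ?x u * (X (T + Suc u * r) \<omega> - X (T + u * r) \<omega>)" .
    qed
    finally show ?thesis .
  qed
  have square_le: "\<sigma>\<^sup>2 * (\<Sum>j<n. (W j \<omega>)\<^sup>2) \<le> \<sigma>\<^sup>2 * real n * b\<^sup>2"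
    if "\<forall>u<K. \<bar>X (q u) \<omega> - X (p u) \<omega>\<bar> \<le> b" for \<omega>
  proof -
    have "(\<Sum>j<n. (W j \<omega>)\<^sup>2) \<le> (\<Sum>j<n. b\<^sup>2)"
    proof (intro sum_mono)
      fix j
      have "\<bar>W j \<omega>\<bar> \<le> b"
        using that ind(1)[of j] pos by (auto simp: W_def)
      then have "\<bar>W j \<omega>\<bar>\<^sup>2 \<le> b\<^sup>2"
        by (intro power_mono) auto
      then show "(W j \<omega>)\<^sup>2 \<le> b\<^sup>2" by simp
    qed
    then show ?thesis
      using mult_left_mono[of _ "real n * b\<^sup>2" "\<sigma>\<^sup>2"] by (simp add: mult.assoc)
  qed
  let ?B = "{\<omega> \<in> space M. \<epsilon> \<le> \<bar>\<Sum>j<n. W j \<omega> * e j \<omega>\<bar> \<and> \<sigma>\<^sup>2 * (\<Sum>j<n. (W j \<omega>)\<^sup>2) \<le> \<sigma>\<^sup>2 * real n * b\<^sup>2}"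
  have V: "0 < \<sigma>\<^sup>2 * real n * b\<^sup>2"
    using \<sigma> pos by simp
  have indep_e: "indep_vars (\<lambda>_. borel) e {..<n}"
    using indep by (simp add: e_def[abs_def])
  have normal_e: "distributed M lborel (e i) (normal_density 0 \<sigma>)" if "i < n" for i
    using normal[OF that] by (simp add: e_def[abs_def])
  have "prob {\<omega> \<in> space M.
      \<epsilon> \<le> \<bar>\<Sum>u<K. (X (q u) \<omega> - X (p u) \<omega>) * (X (T + Suc u * r) \<omega> - X (T + u * r) \<omega>)\<bar> \<and>
      (\<forall>u<K. \<bar>X (q u) \<omega> - X (p u) \<omega>\<bar> \<le> b)} \<le> prob ?B"
    using square_le
    by (intro finite_measure_mono gaussian_martingale_tail(1)[OF indep_e normal_e \<sigma> w W pos(1) V])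
       (auto simp: sum_eq)
  also have "\<dots> \<le> 2 * exp (- \<epsilon>\<^sup>2 / (2 * (\<sigma>\<^sup>2 * real n * b\<^sup>2)))"
    by (rule gaussian_martingale_tail(2)[OF indep_e normal_e \<sigma> w W pos(1) V])
  finally show ?thesis .
qed

text \<open>The centred squares are pairwise orthogonal with second moment \<open>2 * \<sigma> ^ 4\<close>, so this is
  Chebyshev's inequality.\<close>

lemma sum_squares_normal_deviation:
  fixes e :: "'i \<Rightarrow> 'a \<Rightarrow> real"
  assumes fin: "finite A"
    and indep: "indep_vars (\<lambda>_. borel) e A"
    and normal: "\<And>i. i \<in> A \<Longrightarrow> distributed M lborel (e i) (normal_density 0 \<sigma>)"
    and \<sigma>: "0 < \<sigma>" and \<epsilon>: "0 < \<epsilon>"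
  shows "prob {\<omega> \<in> space M. \<epsilon> \<le> \<bar>(\<Sum>i\<in>A. (e i \<omega>)\<^sup>2) - real (card A) * \<sigma>\<^sup>2\<bar>} \<le> 2 * real (card A) * \<sigma> ^ 4 / \<epsilon>\<^sup>2"
proof -
  define Z where "Z i \<omega> = (e i \<omega>)\<^sup>2 - \<sigma>\<^sup>2" for i \<omega>
  have [measurable]: "random_variable borel (e i)" if "i \<in> A" for i
    using indep that by (auto simp: indep_vars_def)
  have [measurable]: "random_variable borel (Z i)" if "i \<in> A" for i
    unfolding Z_def using that by measurable
  have moment: "has_bochner_integral M (\<lambda>\<omega>. (e i \<omega>) ^ (2 * k)) (fact (2 * k) / ((2 / \<sigma>\<^sup>2) ^ k * fact k))"
    if "i \<in> A" for i k
  proof -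
    have *: "has_bochner_integral lborel (\<lambda>x. normal_density 0 \<sigma> x * x ^ (2 * k)) (fact (2 * k) / ((2 / \<sigma>\<^sup>2) ^ k * fact k))"
      using normal_moment_even[OF \<sigma>, of 0 k] by simp
    have "integrable M (\<lambda>\<omega>. (e i \<omega>) ^ (2 * k))"
      using * by (subst distributed_integrable[OF normal[OF that], symmetric]) (auto simp: has_bochner_integral_iff)
    moreover have "expectation (\<lambda>\<omega>. (e i \<omega>) ^ (2 * k)) = fact (2 * k) / ((2 / \<sigma>\<^sup>2) ^ k * fact k)"
      using * by (subst distributed_integral[OF normal[OF that], symmetric]) (auto simp: has_bochner_integral_iff)
    ultimately show ?thesis
      by (simp add: has_bochner_integral_iff)
  qed
  have m2: "has_bochner_integral M (\<lambda>\<omega>. (e i \<omega>)\<^sup>2) (\<sigma>\<^sup>2)" if "i \<in> A" for i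
    using moment[OF that, of 1] by (simp add: fact_numeral)
  have m4: "has_bochner_integral M (\<lambda>\<omega>. (e i \<omega>) ^ 4) (3 * \<sigma> ^ 4)" if "i \<in> A" for i
    using moment[OF that, of 2] by (simp add: fact_numeral power_divide)
  have const: "has_bochner_integral M (\<lambda>_. c) c" for c :: real
    by (simp add: has_bochner_integral_iff prob_space)
  have Z1: "has_bochner_integral M (Z i) 0" if "i \<in> A" for i
    using has_bochner_integral_diff[OF m2[OF that] const[of "\<sigma>\<^sup>2"]]
    by (simp add: Z_def[abs_def])
  have Z2: "has_bochner_integral M (\<lambda>\<omega>. Z i \<omega> * Z i \<omega>) (2 * \<sigma> ^ 4)" if "i \<in> A" for i
  proof -
    have "has_bochner_integral M (\<lambda>\<omega>. ((e i \<omega>) ^ 4 - (2 * \<sigma>\<^sup>2) * (e i \<omega>)\<^sup>2) + \<sigma> ^ 4)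
        ((3 * \<sigma> ^ 4 - (2 * \<sigma>\<^sup>2) * \<sigma>\<^sup>2) + \<sigma> ^ 4)"
      by (intro has_bochner_integral_add has_bochner_integral_diff has_bochner_integral_mult_right
          m2 m4 const that)
    moreover have "((e i \<omega>) ^ 4 - (2 * \<sigma>\<^sup>2) * (e i \<omega>)\<^sup>2) + \<sigma> ^ 4 = Z i \<omega> * Z i \<omega>" for \<omega>
      by (simp add: Z_def power2_eq_square power4_eq_xxxx algebra_simps)
    moreover have "(3 * \<sigma> ^ 4 - (2 * \<sigma>\<^sup>2) * \<sigma>\<^sup>2) + \<sigma> ^ 4 = 2 * \<sigma> ^ 4"
      by (simp add: power2_eq_square power4_eq_xxxx algebra_simps)
    ultimately show ?thesis by simp
  qed
  have ZZ: "has_bochner_integral M (\<lambda>\<omega>. Z i \<omega> * Z j \<omega>) (if i = j then 2 * \<sigma> ^ 4 else 0)"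
    if "i \<in> A" "j \<in> A" for i j
  proof (cases "i = j")
    case True
    then show ?thesis using Z2 that by simp
  next
    case False
    have "indep_vars (\<lambda>_. borel) Z A"
      unfolding Z_def[abs_def] by (rule indep_vars_compose2[OF indep]) auto
    from indep_var_of_indep_vars[OF this that False]
    have iv: "indep_var borel (Z i) borel (Z j)" .
    have int: "integrable M (Z i)" "integrable M (Z j)" "expectation (Z i) = 0"
      using Z1 that by (auto simp: has_bochner_integral_iff)
    show ?thesis
      using indep_var_integrable[OF iv int(1,2)] indep_var_lebesgue_integral[OF iv int(1,2)] int(3) False
      by (simp add: has_bochner_integral_iff)
  qed
  let ?f = "\<lambda>\<omega>. \<Sum>i\<in>A. Z i \<omega>"
  have "has_bochner_integral M (\<lambda>\<omega>. \<Sum>i\<in>A. \<Sum>j\<in>A. Z i \<omega> * Z j \<omega>) (\<Sum>i\<in>A. \<Sum>j\<in>A. if i = j then 2 * \<sigma> ^ 4 else 0)"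
    by (intro has_bochner_integral_sum ZZ)
  then have sq: "has_bochner_integral M (\<lambda>\<omega>. (?f \<omega>)\<^sup>2) (2 * real (card A) * \<sigma> ^ 4)"
    using fin by (simp add: power2_eq_square sum_product mult_ac)
  have "has_bochner_integral M ?f (\<Sum>i\<in>A. 0)"
    by (intro has_bochner_integral_sum Z1)
  then have mean: "expectation ?f = 0"
    by (simp add: has_bochner_integral_iff)
  have "prob {\<omega> \<in> space M. \<bar>?f \<omega> - expectation ?f\<bar> \<ge> \<epsilon>} \<le> variance ?f / \<epsilon>\<^sup>2"
    by (rule Chebyshev_inequality) (use sq \<epsilon> in \<open>auto simp: has_bochner_integral_iff\<close>)
  then have "prob {\<omega> \<in> space M. \<epsilon> \<le> \<bar>?f \<omega>\<bar>} \<le> 2 * real (card A) * \<sigma> ^ 4 / \<epsilon>\<^sup>2"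
    using sq by (simp add: mean has_bochner_integral_iff)
  then show ?thesis
    by (simp add: Z_def sum_subtractf)
qed

text \<open>The Borel-Cantelli lemma after a union bound over the finite sets \<open>I n\<close>.\<close>

lemma AE_eventually_all_not:
  fixes c :: "nat \<Rightarrow> real"
  assumes meas: "\<And>n i. i \<in> I n \<Longrightarrow> {\<omega> \<in> space M. P n i \<omega>} \<in> events"
    and fin: "\<And>n. finite (I n)"
    and le: "\<And>n i. i \<in> I n \<Longrightarrow> prob {\<omega> \<in> space M. P n i \<omega>} \<le> c n"
    and sum: "summable (\<lambda>n. real (card (I n)) * c n)"
  shows "AE \<omega> in M. \<forall>\<^sub>F n in sequentially. \<forall>i\<in>I n. \<not> P n i \<omega>"
proof -
  define A where "A n = (\<Union>i\<in>I n. {\<omega> \<in> space M. P n i \<omega>})" for n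
  have A: "A n \<in> events" for n
    unfolding A_def using fin meas by (intro sets.finite_UN) auto
  have "prob (A n) \<le> real (card (I n)) * c n" for n
  proof -
    have "prob (A n) \<le> (\<Sum>i\<in>I n. prob {\<omega> \<in> space M. P n i \<omega>})"
      unfolding A_def using fin meas by (intro finite_measure_subadditive_finite) auto
    also have "\<dots> \<le> (\<Sum>i\<in>I n. c n)"
      by (intro sum_mono le)
    finally show ?thesis by simp
  qed
  then have "summable (\<lambda>n. prob (A n))"
    by (intro summable_comparison_test'[OF sum, of 0]) simp
  then have "AE \<omega> in M. \<forall>\<^sub>F n in sequentially. \<omega> \<in> space M - A n"
    by (intro borel_cantelli_AE1 A) (auto simp: emeasure_eq_measure)
  then show ?thesis
    by (rule AE_mp) (auto intro!: AE_I2 elim!: eventually_mono simp: A_def)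
qed

end

section \<open>Lagged sums of Brownian increments\<close>

text \<open>Typical paths change by at most a multiple of \<open>holder_ratio ^ n = 2 powr (- n / 4)\<close> over an
  interval of length \<open>1 / 2 ^ n\<close>; the exponent \<open>1 / 4\<close> is one convenient choice below
  \<open>1 / 2\<close>.\<close>

definition holder_ratio :: real where
  "holder_ratio = 2 powr (-1/4)"

lemma holder_ratio_bounds: "0 < holder_ratio" "holder_ratio < 1"
  by (auto simp: holder_ratio_def powr_less_one)

lemma holder_ratio_power4: "holder_ratio ^ 4 = 1 / 2"
proof -
  have "holder_ratio ^ 4 = 2 powr (-1/4 * 4)"
    unfolding holder_ratio_def by (simp add: powr_powr flip: powr_realpow)
  then show ?thesis by (simp add: powr_minus_divide)
qed

lemma holder_ratio_power: "holder_ratio ^ n = 2 powr (- real n / 4)"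
  unfolding holder_ratio_def by (simp add: powr_powr flip: powr_realpow)

text \<open>Chaining along dyadic points costs \<open>r / (1 - r)\<close> at either end of an interval, where \<open>r\<close> is
  the ratio above, and \<open>1\<close> for the step between the two neighbouring grid points:
  \<open>2 * (r / (1 - r)) + 1 = (1 + r) / (1 - r)\<close>.\<close>

definition holder_const :: real where
  "holder_const = (1 + holder_ratio) / (1 - holder_ratio)"

lemma holder_const_pos: "0 < holder_const"
  using holder_ratio_bounds by (simp add: holder_const_def)

text \<open>The path increments in \<open>[t - 1, t]\<close> are weighted by path differences in \<open>[s - 1, s]\<close>. Two
  choices of the indices matter: \<open>c u = u\<close> and \<open>d u = 2 * (u div 2)\<close> give the change of an Ito
  sum under refinement of the partition, and \<open>c = Suc\<close> and \<open>d u = u\<close> give the sum of the products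
  of simultaneous increments, which is the quadratic variation for \<open>s = t\<close>.\<close>

definition lagged_sum :: "(real \<Rightarrow> real) \<Rightarrow> nat \<Rightarrow> (nat \<Rightarrow> nat) \<Rightarrow> (nat \<Rightarrow> nat) \<Rightarrow> real \<Rightarrow> real \<Rightarrow> real" where
  "lagged_sum f n c d s t = (\<Sum>u<2 ^ n.
     (f (s - 1 + real (c u) / 2 ^ n) - f (s - 1 + real (d u) / 2 ^ n)) *
     (f (t - 1 + real (Suc u) / 2 ^ n) - f (t - 1 + real u / 2 ^ n)))"

lemma dyadic_walk:
  fixes B :: "real \<Rightarrow> 'a \<Rightarrow> real"
  assumes bm: "brownian_motion M (-1) 1 B"
  defines "X \<equiv> \<lambda>L i. B (real i / 2 ^ L - 1)"
  shows "i \<le> 2 * 2 ^ L \<Longrightarrow> X L i \<in> borel_measurable M"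
    and "prob_space.indep_vars M (\<lambda>_. borel) (\<lambda>i \<omega>. X L (Suc i) \<omega> - X L i \<omega>) {..<2 * 2 ^ L}"
    and "i < 2 * 2 ^ L \<Longrightarrow> distributed M lborel (\<lambda>\<omega>. X L (Suc i) \<omega> - X L i \<omega>)
      (normal_density 0 (sqrt (1 / 2 ^ L)))"
proof -
  have in_range: "real i / 2 ^ L - 1 \<le> 1" if "i \<le> 2 * 2 ^ L" for i
    using of_nat_mono[OF that, where 'a = real] by (simp add: field_simps)
  show "X L i \<in> borel_measurable M" if "i \<le> 2 * 2 ^ L"
    using bm in_range[OF that] by (auto simp: brownian_motion_def X_def)
  let ?\<tau> = "\<lambda>i. real i / 2 ^ L - 1"
  have "- 1 \<le> ?\<tau> 0 \<and> (\<forall>i<2 * 2 ^ L. ?\<tau> i < ?\<tau> (Suc i)) \<and> ?\<tau> (2 * 2 ^ L) \<le> 1"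
    by (auto simp: field_simps)
  moreover have "\<forall>(n :: nat) \<tau>. - 1 \<le> \<tau> 0 \<and> (\<forall>i<n. \<tau> i < \<tau> (Suc i)) \<and> \<tau> n \<le> 1 \<longrightarrow>
      prob_space.indep_vars M (\<lambda>_. borel) (\<lambda>i \<omega>. B (\<tau> (Suc i)) \<omega> - B (\<tau> i) \<omega>) {..<n}"
    using bm by (simp add: brownian_motion_def)
  ultimately show "prob_space.indep_vars M (\<lambda>_. borel) (\<lambda>i \<omega>. X L (Suc i) \<omega> - X L i \<omega>) {..<2 * 2 ^ L}"
    unfolding X_def by (elim allE[where x = "2 * 2 ^ L"] allE[where x = ?\<tau>]) simp
  show "distributed M lborel (\<lambda>\<omega>. X L (Suc i) \<omega> - X L i \<omega>) (normal_density 0 (sqrt (1 / 2 ^ L)))"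
    if "i < 2 * 2 ^ L"
  proof -
    have "- 1 \<le> ?\<tau> i \<and> ?\<tau> i < ?\<tau> (Suc i) \<and> ?\<tau> (Suc i) \<le> 1"
      using in_range[of "Suc i"] that by (auto simp: field_simps)
    then have "distributed M lborel (\<lambda>\<omega>. B (?\<tau> (Suc i)) \<omega> - B (?\<tau> i) \<omega>) (normal_density 0 (sqrt (?\<tau> (Suc i) - ?\<tau> i)))"
      using bm unfolding brownian_motion_def by blast
    moreover have "?\<tau> (Suc i) - ?\<tau> i = 1 / 2 ^ L"
      by (simp add: field_simps)
    ultimately show ?thesis
      unfolding X_def by simp
  qed
qed

text \<open>On a grid of mesh \<open>1 / 2 ^ L\<close> that contains all the nodes, the hypotheses on \<open>c\<close> and \<open>d\<close> say that
  each weight is determined before the increment that it multiplies. The total variance of the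
  walk is \<open>2\<close>, which yields the constant \<open>4\<close>.\<close>

lemma lagged_sum_tail:
  fixes B :: "real \<Rightarrow> 'a \<Rightarrow> real"
  assumes bm: "brownian_motion M (-1) 1 B"
    and "n \<le> L" and T: "T \<le> 2 ^ L"
    and c: "\<And>u. u < 2 ^ n \<Longrightarrow> S + c u * 2 ^ (L - n) \<le> T + u * 2 ^ (L - n)"
    and d: "\<And>u. u < 2 ^ n \<Longrightarrow> S + d u * 2 ^ (L - n) \<le> T + u * 2 ^ (L - n)"
    and pos: "0 < \<epsilon>" "0 < b"
  defines "A \<equiv> {\<omega> \<in> space M.
      \<epsilon> \<le> \<bar>lagged_sum (\<lambda>x. B x \<omega>) n c d (real S / 2 ^ L) (real T / 2 ^ L)\<bar> \<and>
      (\<forall>u<2 ^ n. \<bar>B (real S / 2 ^ L - 1 + real (c u) / 2 ^ n) \<omega>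
        - B (real S / 2 ^ L - 1 + real (d u) / 2 ^ n) \<omega>\<bar> \<le> b)}"
  shows "A \<in> sets M" and "measure M A \<le> 2 * exp (- \<epsilon>\<^sup>2 / (4 * b\<^sup>2))"
proof -
  interpret prob_space M
    using bm by (simp add: brownian_motion_def)
  define X where "X i = B (real i / 2 ^ L - 1)" for i
  define r :: nat where "r = 2 ^ (L - n)"
  have r: "2 ^ n * r = 2 ^ L" "0 < r"
    using \<open>n \<le> L\<close> by (simp_all add: r_def flip: power_add)
  have node: "B (real i / 2 ^ L - 1 + real k / 2 ^ n) = X (i + k * r)" for i k
  proof -
    have "(2 :: real) ^ n * real r = 2 ^ L"
      using arg_cong[OF r(1), of real] by simp
    then have "real i / 2 ^ L - 1 + real k / 2 ^ n = real (i + k * r) / 2 ^ L - 1"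
      by (simp add: field_simps)
    then show ?thesis unfolding X_def by (simp only:)
  qed
  have block: "T + u * r \<le> 2 * 2 ^ L" if "u \<le> 2 ^ n" for u
    using mult_le_mono1[OF that, of r] T r(1) by simp
  have rv[measurable]: "random_variable borel (X i)" if "i \<le> 2 * 2 ^ L" for i
    unfolding X_def by (rule dyadic_walk(1)[OF bm that])
  have [measurable]: "random_variable borel (X (S + c u * r))" "random_variable borel (X (S + d u * r))"
    "random_variable borel (X (T + u * r))" "random_variable borel (X (T + Suc u * r))" if "u < 2 ^ n" for u
    using c[OF that] d[OF that] block[of u] block[of "Suc u"] that
    by (auto intro!: rv simp del: mult_Suc simp flip: r_def)
  have A_eq: "A = {\<omega> \<in> space M.
      \<epsilon> \<le> \<bar>\<Sum>u<2 ^ n. (X (S + c u * r) \<omega> - X (S + d u * r) \<omega>) * (X (T + Suc u * r) \<omega> - X (T + u * r) \<omega>)\<bar> \<and>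
      (\<forall>u<2 ^ n. \<bar>X (S + c u * r) \<omega> - X (S + d u * r) \<omega>\<bar> \<le> b)}"
    unfolding A_def lagged_sum_def node ..
  have [measurable]: "random_variable borel
      (\<lambda>\<omega>. \<Sum>u<2 ^ n. (X (S + c u * r) \<omega> - X (S + d u * r) \<omega>) * (X (T + Suc u * r) \<omega> - X (T + u * r) \<omega>))"
    by (intro borel_measurable_sum; simp del: mult_Suc)
  show "A \<in> events"
    unfolding A_eq by measurable
  have "prob A \<le> 2 * exp (- \<epsilon>\<^sup>2 / (2 * ((sqrt (1 / 2 ^ L))\<^sup>2 * real (2 * 2 ^ L) * b\<^sup>2)))"
    unfolding A_eq
    by (rule gaussian_walk_bilinear_tail[where n = "2 * 2 ^ L" and K = "2 ^ n" and X = X])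
       (use rv dyadic_walk[OF bm] c d block[of "2 ^ n"] r pos in \<open>auto simp: X_def r_def[symmetric]\<close>)
  also have "2 * ((sqrt (1 / 2 ^ L))\<^sup>2 * real (2 * 2 ^ L) * b\<^sup>2) = 4 * b\<^sup>2"
    by simp
  finally show "prob A \<le> 2 * exp (- \<epsilon>\<^sup>2 / (4 * b\<^sup>2))" .
qed

text \<open>There are \<open>2 * 2 ^ L\<close> increments, and each exceeds its bound with a probability that decays
  faster than exponentially in \<open>L\<close>.\<close>

lemma AE_small_dyadic_increments:
  fixes B :: "real \<Rightarrow> 'a \<Rightarrow> real"
  assumes bm: "brownian_motion M (-1) 1 B"
  shows "AE \<omega> in M. \<forall>\<^sub>F L in sequentially. \<forall>i<2 * 2 ^ L.
    \<bar>B (real (Suc i) / 2 ^ L - 1) \<omega> - B (real i / 2 ^ L - 1) \<omega>\<bar> < holder_ratio ^ L"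
proof -
  interpret prob_space M
    using bm by (simp add: brownian_motion_def)
  let ?P = "\<lambda>L i \<omega>. holder_ratio ^ L \<le> \<bar>B (real (Suc i) / 2 ^ L - 1) \<omega> - B (real i / 2 ^ L - 1) \<omega>\<bar>"
  have "AE \<omega> in M. \<forall>\<^sub>F L in sequentially. \<forall>i\<in>{..<2 * 2 ^ L}. \<not> ?P L i \<omega>"
  proof (rule AE_eventually_all_not)
    fix L i :: nat assume i: "i \<in> {..<2 * 2 ^ L}"
    have [measurable]: "random_variable borel (B (real (Suc i) / 2 ^ L - 1))" "random_variable borel (B (real i / 2 ^ L - 1))"
      using i by (intro dyadic_walk(1)[OF bm]; simp)+
    show "{\<omega> \<in> space M. ?P L i \<omega>} \<in> events"
      by measurable
    have "prob {\<omega> \<in> space M. ?P L i \<omega>} \<le> 2 * exp (- (holder_ratio ^ L)\<^sup>2 / (2 * (sqrt (1 / 2 ^ L))\<^sup>2))"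
      by (rule gaussian_walk_increment_tail[OF dyadic_walk(2)[OF bm] dyadic_walk(3)[OF bm]])
         (use i holder_ratio_bounds in auto)
    also have "- (holder_ratio ^ L)\<^sup>2 / (2 * (sqrt (1 / 2 ^ L))\<^sup>2) = - (2 powr (real L / 2)) / 2"
    proof -
      have "(holder_ratio ^ L)\<^sup>2 * 2 ^ L = 2 powr (- real L / 4) * 2 powr (- real L / 4) * 2 powr real L"
        by (simp only: holder_ratio_power power2_eq_square powr_realpow zero_less_numeral)
      also have "\<dots> = 2 powr (real L / 2)"
        by (simp only: powr_add[symmetric]) simp
      finally show ?thesis by simp
    qed
    finally show "prob {\<omega> \<in> space M. ?P L i \<omega>} \<le> 2 * exp (- (2 powr (real L / 2)) / 2)" .
  next
    have "(\<lambda>L. 2 * 2 ^ L * (2 * exp (- (2 powr (real L / 2)) / 2))) \<in> O(\<lambda>L. 1 / real L ^ 2)"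
      by real_asymp
    from summable_comparison_test_bigo[OF _ this]
    show "summable (\<lambda>L. real (card {..<2 * 2 ^ L :: nat}) * (2 * exp (- (2 powr (real L / 2)) / 2)))"
      using inverse_power_summable[of 2, where 'a = real] by (simp add: inverse_eq_divide)
  qed auto
  then show ?thesis
    by (rule AE_mp) (auto intro!: AE_I2 elim!: eventually_mono simp: not_le)
qed

text \<open>The extra factor \<open>Suc n\<close> in the bound turns the Gaussian tail into \<open>exp (- (n + 1)\<^sup>2 / 4)\<close>,
  which outweighs the roughly \<open>2 ^ (10 * n)\<close> pairs \<open>(S, T)\<close>. The grid has mesh
  \<open>1 / 2 ^ (5 * n)\<close>, much finer than the partition, so that the modulus of continuity of the path
  can later carry the bound over to all pairs of reals.\<close>

lemma AE_lagged_sum_refinement: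
  fixes B :: "real \<Rightarrow> 'a \<Rightarrow> real"
  assumes bm: "brownian_motion M (-1) 1 B"
  shows "AE \<omega> in M. \<forall>\<^sub>F n in sequentially. \<forall>S T. S \<le> T \<and> T \<le> 2 ^ (5 * n) \<longrightarrow>
    (\<forall>u<2 ^ n. \<bar>B (real S / 2 ^ (5 * n) - 1 + real u / 2 ^ n) \<omega>
        - B (real S / 2 ^ (5 * n) - 1 + real (2 * (u div 2)) / 2 ^ n) \<omega>\<bar> \<le> holder_const * holder_ratio ^ n) \<longrightarrow>
    \<bar>lagged_sum (\<lambda>x. B x \<omega>) n (\<lambda>u. u) (\<lambda>u. 2 * (u div 2)) (real S / 2 ^ (5 * n)) (real T / 2 ^ (5 * n))\<bar>
      < real (Suc n) * holder_const * holder_ratio ^ n"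
proof -
  interpret prob_space M
    using bm by (simp add: brownian_motion_def)
  define I :: "nat \<Rightarrow> (nat \<times> nat) set" where
    "I n = {(S, T). S \<le> T \<and> T \<le> 2 ^ (5 * n)}" for n
  have I_sub: "I n \<subseteq> {..2 ^ (5 * n)} \<times> {..2 ^ (5 * n)}" for n
    by (auto simp: I_def)
  have fin: "finite (I n)" for n
    by (rule finite_subset[OF I_sub]) auto
  have card_I: "card (I n) \<le> (2 ^ (5 * n) + 1) * (2 ^ (5 * n) + 1)" for n
    using card_mono[OF _ I_sub[of n]] by simp
  let ?P = "\<lambda>n (S, T) \<omega>.
    real (Suc n) * holder_const * holder_ratio ^ n \<le>
    \<bar>lagged_sum (\<lambda>x. B x \<omega>) n (\<lambda>u. u) (\<lambda>u. 2 * (u div 2)) (real S / 2 ^ (5 * n)) (real T / 2 ^ (5 * n))\<bar> \<and>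
    (\<forall>u<2 ^ n. \<bar>B (real S / 2 ^ (5 * n) - 1 + real u / 2 ^ n) \<omega>
        - B (real S / 2 ^ (5 * n) - 1 + real (2 * (u div 2)) / 2 ^ n) \<omega>\<bar> \<le> holder_const * holder_ratio ^ n)"
  have "AE \<omega> in M. \<forall>\<^sub>F n in sequentially. \<forall>i\<in>I n. \<not> ?P n i \<omega>"
  proof (rule AE_eventually_all_not)
    fix n :: nat and i assume "i \<in> I n"
    then obtain S T where i: "i = (S, T)" and ST: "S \<le> T" "T \<le> 2 ^ (5 * n)"
      by (auto simp: I_def)
    have b: "0 < holder_const * holder_ratio ^ n"
      using holder_const_pos holder_ratio_bounds by simp
    have adapted: "S + u * 2 ^ (5 * n - n) \<le> T + u * 2 ^ (5 * n - n)"
      "S + 2 * (u div 2) * 2 ^ (5 * n - n) \<le> T + u * 2 ^ (5 * n - n)" for u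
      using ST(1) by (auto intro!: add_mono mult_le_mono1)
    note tail = lagged_sum_tail[OF bm _ ST(2) adapted _ b, where \<epsilon> = "real (Suc n) * holder_const * holder_ratio ^ n"]
    show "{\<omega> \<in> space M. ?P n i \<omega>} \<in> events"
      unfolding i prod.case by (rule tail(1)) (use b in \<open>auto simp: mult.assoc\<close>)
    have "prob {\<omega> \<in> space M. ?P n i \<omega>}
        \<le> 2 * exp (- (real (Suc n) * holder_const * holder_ratio ^ n)\<^sup>2 / (4 * (holder_const * holder_ratio ^ n)\<^sup>2))"
      unfolding i prod.case by (rule tail(2)) (use b in \<open>auto simp: mult.assoc\<close>)
    also have "- (real (Suc n) * holder_const * holder_ratio ^ n)\<^sup>2 / (4 * (holder_const * holder_ratio ^ n)\<^sup>2) = - (real (Suc n))\<^sup>2 / 4"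
      using holder_const_pos holder_ratio_bounds by (simp add: power_mult_distrib del: of_nat_Suc)
    finally show "prob {\<omega> \<in> space M. ?P n i \<omega>} \<le> 2 * exp (- (real (Suc n))\<^sup>2 / 4)" .
  next
    have "(\<lambda>n. (2 ^ (5 * n) + 1) * (2 ^ (5 * n) + 1) * (2 * exp (- (real (Suc n))\<^sup>2 / 4))) \<in> O(\<lambda>n. 1 / real n ^ 2)"
      by real_asymp
    from summable_comparison_test_bigo[OF _ this]
    have sum: "summable (\<lambda>n. (2 ^ (5 * n) + 1) * (2 ^ (5 * n) + 1) * (2 * exp (- (real (Suc n))\<^sup>2 / 4)))"
      using inverse_power_summable[of 2, where 'a = real] by (simp add: inverse_eq_divide)
    show "summable (\<lambda>n. real (card (I n)) * (2 * exp (- (real (Suc n))\<^sup>2 / 4)))"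
    proof (rule summable_comparison_test'[OF sum, of 0])
      fix n :: nat
      have "real (card (I n)) \<le> (2 ^ (5 * n) + 1) * (2 ^ (5 * n) + 1)"
        using of_nat_mono[OF card_I[of n], where 'a = real] by (simp add: algebra_simps)
      then show "norm (real (card (I n)) * (2 * exp (- (real (Suc n))\<^sup>2 / 4)))
          \<le> (2 ^ (5 * n) + 1) * (2 ^ (5 * n) + 1) * (2 * exp (- (real (Suc n))\<^sup>2 / 4))"
        unfolding real_norm_def by (subst abs_of_nonneg) (auto intro!: mult_right_mono)
    qed
  qed (rule fin)
  then show ?thesis
  proof (rule AE_mp, intro AE_I2 impI)
    fix \<omega> assume "\<forall>\<^sub>F n in sequentially. \<forall>i\<in>I n. \<not> ?P n i \<omega>"
    then show "\<forall>\<^sub>F n in sequentially. \<forall>S T. S \<le> T \<and> T \<le> 2 ^ (5 * n) \<longrightarrow>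
      (\<forall>u<2 ^ n. \<bar>B (real S / 2 ^ (5 * n) - 1 + real u / 2 ^ n) \<omega>
          - B (real S / 2 ^ (5 * n) - 1 + real (2 * (u div 2)) / 2 ^ n) \<omega>\<bar> \<le> holder_const * holder_ratio ^ n) \<longrightarrow>
      \<bar>lagged_sum (\<lambda>x. B x \<omega>) n (\<lambda>u. u) (\<lambda>u. 2 * (u div 2)) (real S / 2 ^ (5 * n)) (real T / 2 ^ (5 * n))\<bar>
        < real (Suc n) * holder_const * holder_ratio ^ n"
    proof eventually_elim
      case (elim n)
      show ?case
      proof (intro allI impI)
        fix S T assume "S \<le> T \<and> T \<le> 2 ^ (5 * n)"
          and small: "\<forall>u<2 ^ n. \<bar>B (real S / 2 ^ (5 * n) - 1 + real u / 2 ^ n) \<omega>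
            - B (real S / 2 ^ (5 * n) - 1 + real (2 * (u div 2)) / 2 ^ n) \<omega>\<bar> \<le> holder_const * holder_ratio ^ n"
        then have "\<not> ?P n (S, T) \<omega>"
          by (intro bspec[OF elim]) (simp add: I_def)
        then show "\<bar>lagged_sum (\<lambda>x. B x \<omega>) n (\<lambda>u. u) (\<lambda>u. 2 * (u div 2)) (real S / 2 ^ (5 * n)) (real T / 2 ^ (5 * n))\<bar>
          < real (Suc n) * holder_const * holder_ratio ^ n"
          unfolding prod.case using small by (metis (no_types, lifting) not_le)
      qed
    qed
  qed
qed

text \<open>Since \<open>s < t\<close> are on the grid, from level \<open>k\<close> on the two factors of a product are increments over
  disjoint intervals, the first of which is the earlier one.\<close>

lemma AE_lagged_sum_off_diagonal:
  fixes B :: "real \<Rightarrow> 'a \<Rightarrow> real"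
  assumes bm: "brownian_motion M (-1) 1 B" and ST: "S < T" "T \<le> 2 ^ k"
  shows "AE \<omega> in M. \<forall>\<^sub>F n in sequentially.
    (\<forall>u<2 ^ n. \<bar>B (real S / 2 ^ k - 1 + real (Suc u) / 2 ^ n) \<omega>
        - B (real S / 2 ^ k - 1 + real u / 2 ^ n) \<omega>\<bar> \<le> holder_const * holder_ratio ^ n) \<longrightarrow>
    \<bar>lagged_sum (\<lambda>x. B x \<omega>) n Suc (\<lambda>u. u) (real S / 2 ^ k) (real T / 2 ^ k)\<bar>
      < real (Suc n) * holder_const * holder_ratio ^ n"
proof -
  interpret prob_space M
    using bm by (simp add: brownian_motion_def)
  let ?P = "\<lambda>n _ \<omega>.
    real (Suc n) * holder_const * holder_ratio ^ n \<le>
    \<bar>lagged_sum (\<lambda>x. B x \<omega>) n Suc (\<lambda>u. u) (real S / 2 ^ k) (real T / 2 ^ k)\<bar> \<and>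
    (\<forall>u<2 ^ n. \<bar>B (real S / 2 ^ k - 1 + real (Suc u) / 2 ^ n) \<omega>
        - B (real S / 2 ^ k - 1 + real u / 2 ^ n) \<omega>\<bar> \<le> holder_const * holder_ratio ^ n)"
  \<comment> \<open>the index set has one element if \<open>k \<le> n\<close>; at coarser levels \<open>S / 2 ^ k\<close> need not be a grid point, and the index set is empty\<close>
  have "AE \<omega> in M. \<forall>\<^sub>F n in sequentially. \<forall>i\<in>{..<of_bool (k \<le> n) :: nat}. \<not> ?P n i \<omega>"
  proof (rule AE_eventually_all_not)
    fix n i assume "i \<in> {..<of_bool (k \<le> n) :: nat}"
    then have n: "k \<le> n" by (cases "k \<le> n") auto
    have b: "0 < holder_const * holder_ratio ^ n"
      using holder_const_pos holder_ratio_bounds by simp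
    have pow: "2 ^ (n - k) * (2 :: real) ^ k = 2 ^ n"
      using n by (simp flip: power_add)
    have refine: "real j / 2 ^ k = real (j * 2 ^ (n - k)) / 2 ^ n" for j
      unfolding pow[symmetric] by simp
    have "Suc S * 2 ^ (n - k) \<le> T * 2 ^ (n - k)"
      using ST by (intro mult_le_mono1) simp
    then have less: "S * 2 ^ (n - k) < T * 2 ^ (n - k)"
      by (metis ST(1) mult_less_mono1 zero_less_numeral zero_less_power)
    have adapted: "S * 2 ^ (n - k) + Suc u * 2 ^ (n - n) \<le> T * 2 ^ (n - k) + u * 2 ^ (n - n)"
      "S * 2 ^ (n - k) + u * 2 ^ (n - n) \<le> T * 2 ^ (n - k) + u * 2 ^ (n - n)" for u
      unfolding diff_self_eq_0 power_0 mult_1_right using less by linarith+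
    have T': "T * 2 ^ (n - k) \<le> 2 ^ n"
      using mult_le_mono1[OF ST(2), of "2 ^ (n - k)"] n by (simp flip: power_add)
    note tail = lagged_sum_tail[OF bm order_refl T' adapted _ b, where \<epsilon> = "real (Suc n) * holder_const * holder_ratio ^ n"]
    show "{\<omega> \<in> space M. ?P n i \<omega>} \<in> events"
      unfolding refine by (rule tail(1)) (use b in \<open>auto simp: mult.assoc\<close>)
    have "prob {\<omega> \<in> space M. ?P n i \<omega>}
        \<le> 2 * exp (- (real (Suc n) * holder_const * holder_ratio ^ n)\<^sup>2 / (4 * (holder_const * holder_ratio ^ n)\<^sup>2))"
      unfolding refine by (rule tail(2)) (use b in \<open>auto simp: mult.assoc\<close>)
    also have "- (real (Suc n) * holder_const * holder_ratio ^ n)\<^sup>2 / (4 * (holder_const * holder_ratio ^ n)\<^sup>2) = - (real (Suc n))\<^sup>2 / 4"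
      using holder_const_pos holder_ratio_bounds by (simp add: power_mult_distrib del: of_nat_Suc)
    finally show "prob {\<omega> \<in> space M. ?P n i \<omega>} \<le> 2 * exp (- (real (Suc n))\<^sup>2 / 4)" .
  next
    have "(\<lambda>n. 2 * exp (- (real (Suc n))\<^sup>2 / 4)) \<in> O(\<lambda>n. 1 / real n ^ 2)"
      by real_asymp
    from summable_comparison_test_bigo[OF _ this]
    have sum: "summable (\<lambda>n. 2 * exp (- (real (Suc n))\<^sup>2 / 4))"
      using inverse_power_summable[of 2, where 'a = real] by (simp add: inverse_eq_divide)
    show "summable (\<lambda>n. real (card {..<of_bool (k \<le> n) :: nat}) * (2 * exp (- (real (Suc n))\<^sup>2 / 4)))"
    proof (rule summable_comparison_test'[OF sum, of 0])
      fix n :: nat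
      have "real (card {..<of_bool (k \<le> n) :: nat}) \<le> 1"
        by simp
      then show "norm (real (card {..<of_bool (k \<le> n) :: nat}) * (2 * exp (- (real (Suc n))\<^sup>2 / 4)))
          \<le> 2 * exp (- (real (Suc n))\<^sup>2 / 4)"
        unfolding real_norm_def by (subst abs_of_nonneg) (auto intro!: mult_left_le_one_le)
    qed
  qed auto
  then show ?thesis
  proof (rule AE_mp, intro AE_I2 impI)
    fix \<omega> assume "\<forall>\<^sub>F n in sequentially. \<forall>i\<in>{..<of_bool (k \<le> n) :: nat}. \<not> ?P n i \<omega>"
    then show "\<forall>\<^sub>F n in sequentially.
      (\<forall>u<2 ^ n. \<bar>B (real S / 2 ^ k - 1 + real (Suc u) / 2 ^ n) \<omega>
          - B (real S / 2 ^ k - 1 + real u / 2 ^ n) \<omega>\<bar> \<le> holder_const * holder_ratio ^ n) \<longrightarrow>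
      \<bar>lagged_sum (\<lambda>x. B x \<omega>) n Suc (\<lambda>u. u) (real S / 2 ^ k) (real T / 2 ^ k)\<bar>
        < real (Suc n) * holder_const * holder_ratio ^ n"
      using eventually_ge_at_top[of k]
    proof eventually_elim
      case (elim n)
      then have "\<not> ?P n 0 \<omega>"
        by (intro bspec[OF elim(1)]) simp
      then show ?case
        by (metis (no_types, lifting) not_le)
    qed
  qed
qed

text \<open>The sum of squares has mean \<open>1\<close> and variance of order \<open>1 / 2 ^ n\<close>, so Chebyshev's inequality
  gives summable probabilities.\<close>

lemma AE_quadratic_variation:
  fixes B :: "real \<Rightarrow> 'a \<Rightarrow> real"
  assumes bm: "brownian_motion M (-1) 1 B" and S: "S \<le> 2 ^ k"
  shows "AE \<omega> in M. (\<lambda>n. lagged_sum (\<lambda>x. B x \<omega>) n Suc (\<lambda>u. u) (real S / 2 ^ k) (real S / 2 ^ k)) \<longlonglongrightarrow> 1"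
proof -
  interpret prob_space M
    using bm by (simp add: brownian_motion_def)
  let ?Q = "\<lambda>n \<omega>. lagged_sum (\<lambda>x. B x \<omega>) n Suc (\<lambda>u. u) (real S / 2 ^ k) (real S / 2 ^ k)"
  let ?P = "\<lambda>n _ \<omega>. holder_ratio ^ n \<le> \<bar>?Q n \<omega> - 1\<bar>"
  have "AE \<omega> in M. \<forall>\<^sub>F n in sequentially. \<forall>i\<in>{..<of_bool (k \<le> n) :: nat}. \<not> ?P n i \<omega>"
  proof (rule AE_eventually_all_not)
    fix n i assume "i \<in> {..<of_bool (k \<le> n) :: nat}"
    then have n: "k \<le> n" by (cases "k \<le> n") auto
    define R where "R = S * 2 ^ (n - k)"
    define X where "X i = B (real i / 2 ^ n - 1)" for i
    let ?A = "{R..<R + 2 ^ n}"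
    have R: "R + 2 ^ n \<le> 2 * 2 ^ n"
      using mult_le_mono1[OF S, of "2 ^ (n - k)"] n by (simp add: R_def flip: power_add)
    have pow: "2 ^ (n - k) * (2 :: real) ^ k = 2 ^ n"
      using n by (simp flip: power_add)
    have refine: "real S / 2 ^ k = real R / 2 ^ n"
      unfolding pow[symmetric] R_def by simp
    have node: "B (real S / 2 ^ k - 1 + real u / 2 ^ n) = X (R + u)" for u
    proof -
      have "real S / 2 ^ k - 1 + real u / 2 ^ n = real (R + u) / 2 ^ n - 1"
        unfolding refine by (simp add: add_divide_distrib)
      then show ?thesis unfolding X_def by (simp only:)
    qed
    have Q_eq: "?Q n \<omega> = (\<Sum>i\<in>?A. (X (Suc i) \<omega> - X i \<omega>)\<^sup>2)" for \<omega>
    proof -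
      have "?Q n \<omega> = (\<Sum>u\<in>{0..<2 ^ n}. (X (Suc (u + R)) \<omega> - X (u + R) \<omega>)\<^sup>2)"
        unfolding lagged_sum_def node by (simp add: power2_eq_square atLeast0LessThan add.commute)
      also have "\<dots> = (\<Sum>i\<in>?A. (X (Suc i) \<omega> - X i \<omega>)\<^sup>2)"
        using sum.shift_bounds_nat_ivl[of "\<lambda>i. (X (Suc i) \<omega> - X i \<omega>)\<^sup>2" 0 R "2 ^ n"] by (simp add: add.commute)
      finally show ?thesis .
    qed
    have [measurable]: "random_variable borel (X i)" if "i \<le> 2 * 2 ^ n" for i
      unfolding X_def by (rule dyadic_walk(1)[OF bm that])
    have [measurable]: "random_variable borel (?Q n)"
      unfolding Q_eq using R by (intro borel_measurable_sum) auto
    show "{\<omega> \<in> space M. ?P n i \<omega>} \<in> events"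
      by measurable
    have "prob {\<omega> \<in> space M. holder_ratio ^ n \<le> \<bar>(\<Sum>i\<in>?A. (X (Suc i) \<omega> - X i \<omega>)\<^sup>2) - real (card ?A) * (sqrt (1 / 2 ^ n))\<^sup>2\<bar>}
        \<le> 2 * real (card ?A) * sqrt (1 / 2 ^ n) ^ 4 / (holder_ratio ^ n)\<^sup>2"
      unfolding X_def
      by (rule sum_squares_normal_deviation[OF _ indep_vars_subset[OF dyadic_walk(2)[OF bm]] dyadic_walk(3)[OF bm]])
         (use R holder_ratio_bounds in auto)
    moreover have "real (card ?A) * (sqrt (1 / 2 ^ n))\<^sup>2 = 1"
      by simp
    moreover have "2 * real (card ?A) * sqrt (1 / 2 ^ n) ^ 4 / (holder_ratio ^ n)\<^sup>2 = 2 * (holder_ratio\<^sup>2) ^ n"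
    proof -
      have "sqrt (1 / 2 ^ n) ^ 4 = ((sqrt (1 / 2 ^ n))\<^sup>2)\<^sup>2"
        by (simp only: power2_eq_square power4_eq_xxxx mult.assoc)
      also have "(sqrt (1 / 2 ^ n))\<^sup>2 = 1 / 2 ^ n"
        by simp
      finally have 1: "sqrt (1 / 2 ^ n) ^ 4 = (1 / 2 ^ n)\<^sup>2" .
      have "((1 / 2) :: real) ^ n = (holder_ratio ^ n)\<^sup>2 * (holder_ratio ^ n)\<^sup>2"
        unfolding holder_ratio_power4[symmetric] by (simp flip: power_mult power_add)
      then have "1 / 2 ^ n = (holder_ratio ^ n)\<^sup>2 * (holder_ratio ^ n)\<^sup>2"
        by (simp add: power_one_over)
      moreover have "real (card ?A) = 2 ^ n"
        by simp
      ultimately show ?thesis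
        unfolding 1 using holder_ratio_bounds
        by (simp add: field_simps power2_eq_square)
    qed
    ultimately show "prob {\<omega> \<in> space M. ?P n i \<omega>} \<le> 2 * (holder_ratio\<^sup>2) ^ n"
      by (simp only: Q_eq)
  next
    have sum: "summable (\<lambda>n. 2 * (holder_ratio\<^sup>2) ^ n)"
      using holder_ratio_bounds by (intro summable_mult summable_geometric) (auto simp: power_less_one_iff)
    show "summable (\<lambda>n. real (card {..<of_bool (k \<le> n) :: nat}) * (2 * (holder_ratio\<^sup>2) ^ n))"
    proof (rule summable_comparison_test'[OF sum, of 0])
      fix n :: nat
      have "real (card {..<of_bool (k \<le> n) :: nat}) \<le> 1"
        by simp
      then show "norm (real (card {..<of_bool (k \<le> n) :: nat}) * (2 * (holder_ratio\<^sup>2) ^ n)) \<le> 2 * (holder_ratio\<^sup>2) ^ n"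
        using holder_ratio_bounds unfolding real_norm_def by (subst abs_of_nonneg) (auto intro!: mult_left_le_one_le)
    qed
  qed auto
  then show ?thesis
  proof (rule AE_mp, intro AE_I2 impI)
    fix \<omega> assume "\<forall>\<^sub>F n in sequentially. \<forall>i\<in>{..<of_bool (k \<le> n) :: nat}. \<not> ?P n i \<omega>"
    then have "\<forall>\<^sub>F n in sequentially. norm (?Q n \<omega> - 1) \<le> holder_ratio ^ n"
      using eventually_ge_at_top[of k] by eventually_elim (auto simp: not_le)
    moreover have "(\<lambda>n. holder_ratio ^ n) \<longlonglongrightarrow> 0"
      using holder_ratio_bounds by (intro LIMSEQ_realpow_zero) auto
    ultimately have "(\<lambda>n. ?Q n \<omega> - 1) \<longlonglongrightarrow> 0"
      by (rule Lim_null_comparison)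
    then show "(\<lambda>n. ?Q n \<omega>) \<longlonglongrightarrow> 1"
      by (simp add: LIM_zero_iff)
  qed
qed

section \<open>The modulus of continuity of a typical path\<close>

text \<open>The greatest point of the grid \<open>i / 2 ^ L - 1\<close> that is at most \<open>x\<close>, for \<open>-1 \<le> x\<close>.\<close>

definition dyadic_floor :: "nat \<Rightarrow> real \<Rightarrow> real" where
  "dyadic_floor L x = real (nat \<lfloor>2 ^ L * (x + 1)\<rfloor>) / 2 ^ L - 1"

lemma nat_floor_bounds:
  fixes y :: real
  assumes "0 \<le> y"
  shows "real (nat \<lfloor>y\<rfloor>) \<le> y" "y < real (nat \<lfloor>y\<rfloor>) + 1"
proof -
  have "real (nat \<lfloor>y\<rfloor>) = real_of_int \<lfloor>y\<rfloor>"
    using assms by simp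
  then show "real (nat \<lfloor>y\<rfloor>) \<le> y" "y < real (nat \<lfloor>y\<rfloor>) + 1"
    by linarith+
qed

lemma dyadic_floor_bounds:
  assumes "-1 \<le> x"
  shows "dyadic_floor L x \<le> x" "x < dyadic_floor L x + 1 / 2 ^ L"
proof -
  have "0 \<le> 2 ^ L * (x + 1)"
    using assms by simp
  from nat_floor_bounds[OF this]
  have "real (nat \<lfloor>2 ^ L * (x + 1)\<rfloor>) / 2 ^ L \<le> x + 1"
    "x + 1 < (real (nat \<lfloor>2 ^ L * (x + 1)\<rfloor>) + 1) / 2 ^ L"
    by (simp_all only: pos_divide_le_eq pos_less_divide_eq zero_less_power zero_less_numeral mult.commute)
  then show "dyadic_floor L x \<le> x" "x < dyadic_floor L x + 1 / 2 ^ L"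
    unfolding dyadic_floor_def by (simp_all only: add_divide_distrib)
qed

lemma dyadic_floor_ge: "-1 \<le> dyadic_floor L x"
  by (simp add: dyadic_floor_def)

lemma dyadic_floor_tendsto:
  assumes "-1 \<le> x"
  shows "(\<lambda>L. dyadic_floor L x) \<longlonglongrightarrow> x"
proof (rule tendsto_sandwich[OF _ _ _ tendsto_const])
  have "x - 1 / 2 ^ L \<le> dyadic_floor L x" for L
    using dyadic_floor_bounds(2)[OF assms, of L] by simp
  then show "\<forall>\<^sub>F L in sequentially. x - 1 / 2 ^ L \<le> dyadic_floor L x"
    by simp
  show "\<forall>\<^sub>F L in sequentially. dyadic_floor L x \<le> x"
    using dyadic_floor_bounds(1)[OF assms] by simp
  show "(\<lambda>L. x - 1 / 2 ^ L) \<longlonglongrightarrow> x"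
    by real_asymp
qed

text \<open>Points of the coarser partition, translated by any \<open>x\<close>, are rounded by a common translation.
  This is why rounding \<open>s\<close> and \<open>t\<close> rounds all nodes of a lagged sum at once.\<close>

lemma dyadic_floor_shift:
  assumes "-1 \<le> x" "n \<le> L"
  shows "dyadic_floor L (x + real u / 2 ^ n) = dyadic_floor L x + real u / 2 ^ n"
proof -
  have pow: "2 ^ (L - n) * (2 :: real) ^ n = 2 ^ L"
    using assms(2) by (simp flip: power_add)
  define k where "k = u * 2 ^ (L - n)"
  have "2 ^ L * (x + real u / 2 ^ n + 1) = 2 ^ L * (x + 1) + real_of_int (int k)"
    unfolding pow[symmetric] k_def by (simp add: field_simps)
  then have "\<lfloor>2 ^ L * (x + real u / 2 ^ n + 1)\<rfloor> = \<lfloor>2 ^ L * (x + 1)\<rfloor> + int k"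
    by (simp only: floor_add_int)
  then have "nat \<lfloor>2 ^ L * (x + real u / 2 ^ n + 1)\<rfloor> = nat \<lfloor>2 ^ L * (x + 1)\<rfloor> + k"
    using assms(1) by (simp add: nat_add_distrib)
  moreover have "real k / 2 ^ L = real u / 2 ^ n"
    unfolding pow[symmetric] k_def by simp
  ultimately show ?thesis
    unfolding dyadic_floor_def by (simp add: add_divide_distrib)
qed

text \<open>The almost sure properties of a Brownian path from which everything else follows without
  probability.\<close>

locale typical_path =
  fixes f :: "real \<Rightarrow> real"
  assumes continuous: "continuous_on {-1..1} f"
    and increments: "\<forall>\<^sub>F L in sequentially. \<forall>i<2 * 2 ^ L.
      \<bar>f (real (Suc i) / 2 ^ L - 1) - f (real i / 2 ^ L - 1)\<bar> < holder_ratio ^ L"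
    and refinement: "\<forall>\<^sub>F n in sequentially. \<forall>S T. S \<le> T \<and> T \<le> 2 ^ (5 * n) \<longrightarrow>
      (\<forall>u<2 ^ n. \<bar>f (real S / 2 ^ (5 * n) - 1 + real u / 2 ^ n)
          - f (real S / 2 ^ (5 * n) - 1 + real (2 * (u div 2)) / 2 ^ n)\<bar> \<le> holder_const * holder_ratio ^ n) \<longrightarrow>
      \<bar>lagged_sum f n (\<lambda>u. u) (\<lambda>u. 2 * (u div 2)) (real S / 2 ^ (5 * n)) (real T / 2 ^ (5 * n))\<bar>
        < real (Suc n) * holder_const * holder_ratio ^ n"
    and off_diagonal: "\<And>S T k. S < T \<Longrightarrow> T \<le> 2 ^ k \<Longrightarrow> \<forall>\<^sub>F n in sequentially.
      (\<forall>u<2 ^ n. \<bar>f (real S / 2 ^ k - 1 + real (Suc u) / 2 ^ n)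
          - f (real S / 2 ^ k - 1 + real u / 2 ^ n)\<bar> \<le> holder_const * holder_ratio ^ n) \<longrightarrow>
      \<bar>lagged_sum f n Suc (\<lambda>u. u) (real S / 2 ^ k) (real T / 2 ^ k)\<bar> < real (Suc n) * holder_const * holder_ratio ^ n"
    and quadratic_variation: "\<And>S k. S \<le> 2 ^ k \<Longrightarrow>
      (\<lambda>n. lagged_sum f n Suc (\<lambda>u. u) (real S / 2 ^ k) (real S / 2 ^ k)) \<longlonglongrightarrow> 1"
begin

text \<open>The values at successive roundings of \<open>x\<close> differ by at most one dyadic increment each. The
  resulting geometric series bounds the distance to the limit, which is \<open>f x\<close> by continuity.\<close>

lemma dyadic_approximation:
  "\<forall>\<^sub>F m in sequentially. \<forall>x\<in>{-1..1}. \<bar>f x - f (dyadic_floor m x)\<bar> \<le> holder_ratio / (1 - holder_ratio) * holder_ratio ^ m"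
proof -
  from increments obtain m0 where m0: "\<And>L i. L \<ge> m0 \<Longrightarrow> i < 2 * 2 ^ L \<Longrightarrow>
      \<bar>f (real (Suc i) / 2 ^ L - 1) - f (real i / 2 ^ L - 1)\<bar> < holder_ratio ^ L"
    unfolding eventually_sequentially by blast
  have "\<bar>f x - f (dyadic_floor m x)\<bar> \<le> holder_ratio / (1 - holder_ratio) * holder_ratio ^ m"
    if m: "m0 \<le> m" and x: "x \<in> {-1..1}" for m x
  proof -
    have step: "\<bar>f (dyadic_floor (Suc L) x) - f (dyadic_floor L x)\<bar> \<le> holder_ratio ^ Suc L" if "m0 \<le> L" for L
    proof -
      define i where "i = nat \<lfloor>2 ^ L * (x + 1)\<rfloor>"
      define j where "j = nat \<lfloor>2 ^ Suc L * (x + 1)\<rfloor>"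
      have i: "real i \<le> 2 ^ L * (x + 1)" "2 ^ L * (x + 1) < real i + 1"
        using nat_floor_bounds[of "2 ^ L * (x + 1)"] x by (simp_all only: i_def) simp_all
      have j: "real j \<le> 2 ^ Suc L * (x + 1)" "2 ^ Suc L * (x + 1) < real j + 1"
        using nat_floor_bounds[of "2 ^ Suc L * (x + 1)"] x by (simp_all only: j_def) simp_all
      have "real (2 * i) < real (j + 1)" "real j < real (2 * i + 2)"
        using i j by simp_all
      then have ij: "j = 2 * i \<or> j = Suc (2 * i)"
        by linarith
      have L: "dyadic_floor L x = real (2 * i) / 2 ^ Suc L - 1"
        by (simp add: dyadic_floor_def i_def)
      have SL: "dyadic_floor (Suc L) x = real j / 2 ^ Suc L - 1"
        by (simp add: dyadic_floor_def j_def)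
      show ?thesis
      proof (cases "j = 2 * i")
        case True
        then show ?thesis
          using holder_ratio_bounds by (simp only: L SL) simp
      next
        case False
        have "2 ^ Suc L * (x + 1) \<le> 2 ^ Suc L * 2"
          using x by (intro mult_left_mono) auto
        from order_trans[OF j(1) this] have "real j \<le> real (2 * 2 ^ Suc L)"
          by (simp only: of_nat_mult of_nat_power of_nat_numeral mult.commute)
        then have "2 * i < 2 * 2 ^ Suc L"
          using ij False by linarith
        from m0[OF _ this, of ] that have "\<bar>f (real (Suc (2 * i)) / 2 ^ Suc L - 1) - f (real (2 * i) / 2 ^ Suc L - 1)\<bar> < holder_ratio ^ Suc L"
          by simp
        moreover have "j = Suc (2 * i)"
          using ij False by blast
        ultimately show ?thesis
          by (simp only: L SL less_imp_le)
      qed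
    qed
    have chain: "\<bar>f (dyadic_floor (m + k) x) - f (dyadic_floor m x)\<bar> \<le> holder_ratio / (1 - holder_ratio) * holder_ratio ^ m" for k
    proof -
      have "f (dyadic_floor (m + k) x) - f (dyadic_floor m x)
          = (\<Sum>i<k. f (dyadic_floor (m + Suc i) x) - f (dyadic_floor (m + i) x))"
        using sum_lessThan_telescope[of "\<lambda>i. f (dyadic_floor (m + i) x)" k] by simp
      also have "\<bar>\<dots>\<bar> \<le> (\<Sum>i<k. \<bar>f (dyadic_floor (m + Suc i) x) - f (dyadic_floor (m + i) x)\<bar>)"
        by (rule sum_abs)
      also have "\<dots> \<le> (\<Sum>i<k. holder_ratio ^ Suc m * holder_ratio ^ i)"
      proof (rule sum_mono)
        fix i
        show "\<bar>f (dyadic_floor (m + Suc i) x) - f (dyadic_floor (m + i) x)\<bar> \<le> holder_ratio ^ Suc m * holder_ratio ^ i"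
          using step[of "m + i"] m by (simp add: power_add mult_ac)
      qed
      also have "\<dots> = holder_ratio ^ Suc m * (\<Sum>i<k. holder_ratio ^ i)"
        by (simp add: sum_distrib_left)
      also have "\<dots> \<le> holder_ratio ^ Suc m * (1 / (1 - holder_ratio))"
        using holder_ratio_bounds
        by (intro mult_left_mono) (simp_all add: sum_gp_strict divide_right_mono)
      finally show ?thesis
        by (simp add: mult_ac)
    qed
    have "(\<lambda>k. dyadic_floor (m + k) x) \<longlonglongrightarrow> x"
      using LIMSEQ_ignore_initial_segment[OF dyadic_floor_tendsto, of x m] x by (simp add: add.commute)
    moreover have "dyadic_floor (m + k) x \<in> {-1..1}" for k
      using dyadic_floor_ge[of "m + k" x] dyadic_floor_bounds(1)[of x "m + k"] x by auto
    ultimately have "(\<lambda>k. f (dyadic_floor (m + k) x)) \<longlonglongrightarrow> f x"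
      using x by (intro continuous_on_tendsto_compose[OF continuous]) (simp_all add: always_eventually)
    then have "(\<lambda>k. \<bar>f (dyadic_floor (m + k) x) - f (dyadic_floor m x)\<bar>) \<longlonglongrightarrow> \<bar>f x - f (dyadic_floor m x)\<bar>"
      by (intro tendsto_intros)
    then show ?thesis
      by (rule LIMSEQ_le_const2) (use chain in auto)
  qed
  then show ?thesis
    unfolding eventually_sequentially by blast
qed

text \<open>The roundings of \<open>x\<close> and \<open>x + 1 / 2 ^ m\<close> are neighbours on the grid of level \<open>m\<close>.\<close>

lemma modulus:
  "\<forall>\<^sub>F m in sequentially. \<forall>x\<in>{-1..1}. \<bar>f x - f (dyadic_floor m x)\<bar> \<le> holder_const * holder_ratio ^ m \<and>
    (x + 1 / 2 ^ m \<le> 1 \<longrightarrow> \<bar>f (x + 1 / 2 ^ m) - f x\<bar> \<le> holder_const * holder_ratio ^ m)"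
  using dyadic_approximation increments
proof eventually_elim
  case (elim m)
  show ?case
  proof (intro ballI conjI impI)
    fix x :: real assume x: "x \<in> {-1..1}"
    let ?C = "holder_ratio / (1 - holder_ratio)"
    have C: "?C \<le> holder_const" "2 * ?C + 1 = holder_const"
      using holder_ratio_bounds by (auto simp: holder_const_def field_simps)
    have pos: "0 < holder_ratio ^ m"
      using holder_ratio_bounds by simp
    have "\<bar>f x - f (dyadic_floor m x)\<bar> \<le> ?C * holder_ratio ^ m"
      using elim(1) x by blast
    also have "\<dots> \<le> holder_const * holder_ratio ^ m"
      using C(1) pos by (intro mult_right_mono) auto
    finally show "\<bar>f x - f (dyadic_floor m x)\<bar> \<le> holder_const * holder_ratio ^ m" .
    assume le: "x + 1 / 2 ^ m \<le> 1"
    define i where "i = nat \<lfloor>2 ^ m * (x + 1)\<rfloor>"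
    have here: "dyadic_floor m x = real i / 2 ^ m - 1"
      by (simp add: dyadic_floor_def i_def)
    have there: "dyadic_floor m (x + 1 / 2 ^ m) = real (Suc i) / 2 ^ m - 1"
      using dyadic_floor_shift[of x m m 1] x here by (simp add: add_divide_distrib)
    have ge: "-1 \<le> x + 1 / 2 ^ m"
      using x by (auto intro: add_increasing2)
    from dyadic_floor_bounds(1)[OF ge, of m] have "real (Suc i) / 2 ^ m - 1 \<le> 1"
      unfolding there using le by linarith
    then have "real (Suc i) \<le> real (2 * 2 ^ m)"
      by (simp add: field_simps)
    then have "i < 2 * 2 ^ m"
      by linarith
    with elim(2) have "\<bar>f (real (Suc i) / 2 ^ m - 1) - f (real i / 2 ^ m - 1)\<bar> < holder_ratio ^ m"
      by blast
    then have "\<bar>f (dyadic_floor m (x + 1 / 2 ^ m)) - f (dyadic_floor m x)\<bar> < holder_ratio ^ m"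
      by (simp only: here there)
    moreover have "\<bar>f x - f (dyadic_floor m x)\<bar> \<le> ?C * holder_ratio ^ m"
      using elim(1) x by blast
    moreover have "\<bar>f (x + 1 / 2 ^ m) - f (dyadic_floor m (x + 1 / 2 ^ m))\<bar> \<le> ?C * holder_ratio ^ m"
      using elim(1) ge le by (meson atLeastAtMost_iff)
    ultimately have "\<bar>f (x + 1 / 2 ^ m) - f x\<bar> \<le> 2 * (?C * holder_ratio ^ m) + holder_ratio ^ m"
      by linarith
    also have "\<dots> = holder_const * holder_ratio ^ m"
      unfolding C(2)[symmetric] by (simp add: algebra_simps)
    finally show "\<bar>f (x + 1 / 2 ^ m) - f x\<bar> \<le> holder_const * holder_ratio ^ m" .
  qed
qed

end

section \<open>Ito sums and their uniform convergence\<close>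

text \<open>The diagonal is included: continuity of the limit up to the diagonal is what produces both the
  uniformly continuous extension and the value of the jump.\<close>

definition closed_triangle :: "(real \<times> real) set" where
  "closed_triangle = {(s, t). 0 \<le> s \<and> s \<le> t \<and> t \<le> 1}"

definition ito_sum :: "(real \<Rightarrow> real) \<Rightarrow> nat \<Rightarrow> real \<times> real \<Rightarrow> real" where
  "ito_sum f n = (\<lambda>(s, t). \<Sum>u<2 ^ n. f (s - 1 + real u / 2 ^ n) *
     (f (t - 1 + real (Suc u) / 2 ^ n) - f (t - 1 + real u / 2 ^ n)))"

definition boundary_term :: "(real \<Rightarrow> real) \<Rightarrow> real \<times> real \<Rightarrow> real" where
  "boundary_term f = (\<lambda>(s, t). f (t - 1) * (f s - f (s - 1)) - f (s - 1) * (f t - f (t - 1))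
     - (f s * f t - f (s - 1) * f (t - 1)))"

text \<open>Written on the finer partition, the coarse Ito sum evaluates the integrand at the last even
  node \<open>2 * (u div 2)\<close> instead of \<open>u\<close>.\<close>

lemma ito_sum_Suc:
  "ito_sum f (Suc n) (s, t) - ito_sum f n (s, t) = lagged_sum f (Suc n) (\<lambda>u. u) (\<lambda>u. 2 * (u div 2)) s t"
proof -
  define a where "a u = f (s - 1 + real u / 2 ^ Suc n)" for u
  define b where "b u = f (t - 1 + real u / 2 ^ Suc n)" for u
  have coarse: "f (s - 1 + real u / 2 ^ n) = a (2 * u)" "f (t - 1 + real u / 2 ^ n) = b (2 * u)" for u
    by (simp_all add: a_def b_def)
  have "(\<Sum>u<2 ^ Suc n. a (2 * (u div 2)) * (b (Suc u) - b u))
      = (\<Sum>v<2 ^ n. \<Sum>u = v * 2..<v * 2 + 2. a (2 * (u div 2)) * (b (Suc u) - b u))"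
    using sum.nat_group[of "\<lambda>u. a (2 * (u div 2)) * (b (Suc u) - b u)" 2 "2 ^ n"] by (simp add: mult.commute)
  also have "\<dots> = (\<Sum>v<2 ^ n. a (2 * v) * (b (2 * Suc v) - b (2 * v)))"
  proof (intro sum.cong refl)
    fix v
    have "{v * 2..<v * 2 + 2} = {2 * v, Suc (2 * v)}"
      by auto
    then show "(\<Sum>u = v * 2..<v * 2 + 2. a (2 * (u div 2)) * (b (Suc u) - b u))
        = a (2 * v) * (b (2 * Suc v) - b (2 * v))"
      by (simp add: algebra_simps)
  qed
  also have "\<dots> = ito_sum f n (s, t)"
    unfolding ito_sum_def prod.case coarse ..
  finally have "ito_sum f n (s, t) = (\<Sum>u<2 ^ Suc n. a (2 * (u div 2)) * (b (Suc u) - b u))" ..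
  then show ?thesis
    unfolding ito_sum_def lagged_sum_def prod.case a_def[symmetric] b_def[symmetric]
    by (simp only: left_diff_distrib sum_subtractf)
qed

text \<open>Discrete integration by parts replaces the sum of \<open>b v * (a (Suc v) - a v)\<close>, whose integrand looks
  into the future when \<open>s < t\<close>, by an Ito sum and a sum of products of increments.\<close>

lemma polygonal_levy_area_eq_ito_sum:
  "polygonal_levy_area (segment_process f) n (s, t)
    = ito_sum f n (s, t) + 1 / 2 * lagged_sum f n Suc (\<lambda>u. u) s t + 1 / 2 * boundary_term f (s, t)"
proof -
  let ?N = "2 ^ n :: nat"
  define a where "a u = f (s - 1 + real u / 2 ^ n)" for u
  define b where "b u = f (t - 1 + real u / 2 ^ n)" for u
  have ends: "f (s - 1) = a 0" "f (t - 1) = b 0" "f s = a ?N" "f t = b ?N"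
    by (simp_all add: a_def b_def)
  have seg: "segment_process f (real u / 2 ^ n) s = a u" "segment_process f (real u / 2 ^ n) t = b u"
    "segment_process f 0 s = a 0" "segment_process f 0 t = b 0" for u
    by (simp_all add: segment_process_def a_def b_def algebra_simps)
  have area: "polygonal_levy_area (segment_process f) n (s, t)
      = 1 / 2 * (\<Sum>v<?N. (a v - a 0) * (b (Suc v) - b v) - (b v - b 0) * (a (Suc v) - a v))"
  proof -
    have "(\<Sum>v<?N. (a v - a 0) * (b (Suc v) - b v) - (b v - b 0) * (a (Suc v) - a v))
        = (\<Sum>v = 1..?N - 1. (a v - a 0) * (b (Suc v) - b v) - (b v - b 0) * (a (Suc v) - a v))"
    proof (rule sum.mono_neutral_right)
      show "\<forall>v\<in>{..<?N} - {1..?N - 1}. (a v - a 0) * (b (Suc v) - b v) - (b v - b 0) * (a (Suc v) - a v) = 0"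
      proof
        fix v assume "v \<in> {..<?N} - {1..?N - 1}"
        then have "v = 0" by (cases v) auto
        then show "(a v - a 0) * (b (Suc v) - b v) - (b v - b 0) * (a (Suc v) - a v) = 0"
          by simp
      qed
      show "{1..?N - 1} \<subseteq> {..<?N}"
        using zero_less_power[of "2 :: nat" n] by (auto simp del: zero_less_power)
    qed simp
    then show ?thesis
      unfolding polygonal_levy_area_def prod.case seg Suc_eq_plus1 by simp
  qed
  have parts: "(\<Sum>v<?N. a v * (b (Suc v) - b v)) + (\<Sum>v<?N. b v * (a (Suc v) - a v))
      + (\<Sum>v<?N. (a (Suc v) - a v) * (b (Suc v) - b v)) = a ?N * b ?N - a 0 * b 0"
  proof -
    have "(\<Sum>v<?N. a v * (b (Suc v) - b v)) + (\<Sum>v<?N. b v * (a (Suc v) - a v))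
        + (\<Sum>v<?N. (a (Suc v) - a v) * (b (Suc v) - b v)) = (\<Sum>v<?N. a (Suc v) * b (Suc v) - a v * b v)"
      by (simp add: algebra_simps flip: sum.distrib sum_subtractf)
    also have "\<dots> = a ?N * b ?N - a 0 * b 0"
      by (rule sum_lessThan_telescope)
    finally show ?thesis .
  qed
  have halve: "x = y + 1 / 2 * z + 1 / 2 * w" if "2 * x = 2 * y + z + w" for x y z w :: real
    using that by simp
  have split: "(\<Sum>v<?N. (a v - a0) * y v - (b v - b0) * x v)
      = (\<Sum>v<?N. a v * y v) - a0 * (\<Sum>v<?N. y v) - ((\<Sum>v<?N. b v * x v) - b0 * (\<Sum>v<?N. x v))"
    for a0 b0 and x y :: "nat \<Rightarrow> real"
    by (simp only: left_diff_distrib sum_subtractf sum_distrib_left)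
  have "(\<Sum>v<?N. (a v - a 0) * (b (Suc v) - b v) - (b v - b 0) * (a (Suc v) - a v))
      = (\<Sum>v<?N. a v * (b (Suc v) - b v)) - a 0 * (\<Sum>v<?N. b (Suc v) - b v)
        - ((\<Sum>v<?N. b v * (a (Suc v) - a v)) - b 0 * (\<Sum>v<?N. a (Suc v) - a v))"
    by (rule split)
  also have "(\<Sum>v<?N. b (Suc v) - b v) = b ?N - b 0"
    by (rule sum_lessThan_telescope)
  also have "(\<Sum>v<?N. a (Suc v) - a v) = a ?N - a 0"
    by (rule sum_lessThan_telescope)
  finally have "2 * polygonal_levy_area (segment_process f) n (s, t)
      = 2 * (\<Sum>v<?N. a v * (b (Suc v) - b v)) + (\<Sum>v<?N. (a (Suc v) - a v) * (b (Suc v) - b v))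
        + (b 0 * (a ?N - a 0) - a 0 * (b ?N - b 0) - (a ?N * b ?N - a 0 * b 0))"
    unfolding area using parts by simp
  from halve[OF this] show ?thesis
    unfolding ito_sum_def lagged_sum_def boundary_term_def prod.case ends a_def[symmetric] b_def[symmetric] .
qed

context typical_path
begin

lemma unit_shift_in_range:
  fixes s :: real
  assumes "0 \<le> s" "s \<le> 1" "u \<le> 2 ^ n"
  shows "s - 1 + real u / 2 ^ n \<in> {-1..1}"
proof -
  have "real u / 2 ^ n \<le> 1"
    using of_nat_mono[OF assms(3), where 'a = real] by (simp add: field_simps)
  moreover have "0 \<le> real u / 2 ^ n"
    by simp
  ultimately show ?thesis
    unfolding atLeastAtMost_iff using assms(1,2) by linarith
qed

text \<open>Rounding \<open>s\<close> and \<open>t\<close> down to the grid of mesh \<open>1 / 2 ^ (5 * n)\<close> changes each of the \<open>2 ^ n\<close>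
  products by at most a multiple of \<open>holder_ratio ^ (5 * n)\<close>. As \<open>2 * holder_ratio ^ 4 = 1\<close>, the total
  error is still of order \<open>holder_ratio ^ n\<close>.\<close>

lemma refinement_bound:
  "\<forall>\<^sub>F n in sequentially. \<forall>(s, t)\<in>closed_triangle.
    \<bar>lagged_sum f n (\<lambda>u. u) (\<lambda>u. 2 * (u div 2)) s t\<bar>
      \<le> real (Suc n) * holder_const * holder_ratio ^ n + 4 * holder_const\<^sup>2 * holder_ratio ^ n"
proof -
  from modulus obtain m0 where m0: "\<And>m x. m \<ge> m0 \<Longrightarrow> x \<in> {-1..1} \<Longrightarrow>
      \<bar>f x - f (dyadic_floor m x)\<bar> \<le> holder_const * holder_ratio ^ m"
    "\<And>m x. m \<ge> m0 \<Longrightarrow> x \<in> {-1..1} \<Longrightarrow> x + 1 / 2 ^ m \<le> 1 \<Longrightarrow>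
      \<bar>f (x + 1 / 2 ^ m) - f x\<bar> \<le> holder_const * holder_ratio ^ m"
    unfolding eventually_sequentially by blast
  show ?thesis
    using refinement eventually_ge_at_top[of m0]
  proof eventually_elim
    case (elim n)
    let ?D = "holder_const"
    have D: "0 < ?D" "0 < holder_ratio ^ n" "holder_ratio ^ n \<le> 1" "0 < holder_ratio ^ (5 * n)"
      using holder_const_pos holder_ratio_bounds by (auto intro!: power_le_one)
    have increment: "\<bar>f (s - 1 + real (Suc u) / 2 ^ n) - f (s - 1 + real u / 2 ^ n)\<bar> \<le> ?D * holder_ratio ^ n"
      if "0 \<le> s" "s \<le> 1" "u < 2 ^ n" for s u
    proof -
      have "s - 1 + real (Suc u) / 2 ^ n = s - 1 + real u / 2 ^ n + 1 / 2 ^ n"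
        by (simp add: add_divide_distrib)
      then show ?thesis
        using m0(2)[OF elim(2), of "s - 1 + real u / 2 ^ n"] unit_shift_in_range[OF that(1,2), of u n]
          unit_shift_in_range[OF that(1,2), of "Suc u" n] that(3)
        by (metis Suc_leI atLeastAtMost_iff less_imp_le)
    qed
    have even_increment: "\<bar>f (s - 1 + real u / 2 ^ n) - f (s - 1 + real (2 * (u div 2)) / 2 ^ n)\<bar> \<le> ?D * holder_ratio ^ n"
      if "0 \<le> s" "s \<le> 1" "u < 2 ^ n" for s u
    proof (cases "even u")
      case True
      then show ?thesis using D by simp
    next
      case False
      then have u: "u = Suc (2 * (u div 2))"
        by (metis odd_Suc_div_two odd_two_times_div_two_succ Suc_eq_plus1)
      show ?thesis
        using increment[OF that(1,2), of "2 * (u div 2)"] u that(3) by (metis Suc_lessD)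
    qed
    show ?case
    proof safe
      fix s t assume "(s, t) \<in> closed_triangle"
      then have st: "0 \<le> s" "s \<le> t" "t \<le> 1"
        by (auto simp: closed_triangle_def)
      define S where "S = nat \<lfloor>2 ^ (5 * n) * s\<rfloor>"
      define T where "T = nat \<lfloor>2 ^ (5 * n) * t\<rfloor>"
      define s' where "s' = real S / 2 ^ (5 * n)"
      define t' where "t' = real T / 2 ^ (5 * n)"
      have ST: "S \<le> T" "T \<le> 2 ^ (5 * n)"
      proof -
        show "S \<le> T"
          unfolding S_def T_def using st by (intro nat_mono floor_mono mult_left_mono) auto
        have "2 ^ (5 * n) * t \<le> 2 ^ (5 * n)"
          using st by simp
        moreover have "real T \<le> 2 ^ (5 * n) * t"
          unfolding T_def using st by (intro nat_floor_bounds) simp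
        ultimately have "real T \<le> 2 ^ (5 * n)"
          by linarith
        then have "real T \<le> real (2 ^ (5 * n))"
          by (simp only: of_nat_power of_nat_numeral)
        then show "T \<le> 2 ^ (5 * n)"
          by (simp only: of_nat_le_iff)
      qed
      have ST': "0 \<le> s'" "s' \<le> 1" "0 \<le> t'" "t' \<le> 1"
        using ST of_nat_mono[OF ST(2), where 'a = real] of_nat_mono[OF order_trans[OF ST], where 'a = real]
        by (auto simp: s'_def t'_def field_simps)
      have node: "dyadic_floor (5 * n) (s - 1 + real u / 2 ^ n) = s' - 1 + real u / 2 ^ n"
        "dyadic_floor (5 * n) (t - 1 + real u / 2 ^ n) = t' - 1 + real u / 2 ^ n" for u
      proof -
        have "dyadic_floor (5 * n) (s - 1) = s' - 1" "dyadic_floor (5 * n) (t - 1) = t' - 1"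
          by (simp_all add: dyadic_floor_def s'_def S_def t'_def T_def)
        then show "dyadic_floor (5 * n) (s - 1 + real u / 2 ^ n) = s' - 1 + real u / 2 ^ n"
          "dyadic_floor (5 * n) (t - 1 + real u / 2 ^ n) = t' - 1 + real u / 2 ^ n"
          using st dyadic_floor_shift[of "s - 1" n "5 * n" u] dyadic_floor_shift[of "t - 1" n "5 * n" u] by simp_all
      qed
      have near: "\<bar>f (s - 1 + real u / 2 ^ n) - f (s' - 1 + real u / 2 ^ n)\<bar> \<le> ?D * holder_ratio ^ (5 * n)"
        "\<bar>f (t - 1 + real u / 2 ^ n) - f (t' - 1 + real u / 2 ^ n)\<bar> \<le> ?D * holder_ratio ^ (5 * n)" if "u \<le> 2 ^ n" for u
        using m0(1)[of "5 * n" "s - 1 + real u / 2 ^ n"] m0(1)[of "5 * n" "t - 1 + real u / 2 ^ n"]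
          unit_shift_in_range[OF _ _ that] st elim(2) by (simp_all add: node)
      let ?lag = "lagged_sum f n (\<lambda>u. u) (\<lambda>u. 2 * (u div 2))"
      have grid: "\<bar>?lag s' t'\<bar> < real (Suc n) * ?D * holder_ratio ^ n"
        using elim(1) ST even_increment[OF ST'(1,2)] unfolding s'_def t'_def by blast
      let ?x = "\<lambda>s u. f (s - 1 + real u / 2 ^ n) - f (s - 1 + real (2 * (u div 2)) / 2 ^ n)"
      let ?y = "\<lambda>t u. f (t - 1 + real (Suc u) / 2 ^ n) - f (t - 1 + real u / 2 ^ n)"
      have termwise: "\<bar>?x s u * ?y t u - ?x s' u * ?y t' u\<bar> \<le> 4 * ?D\<^sup>2 * holder_ratio ^ (5 * n)" if u: "u < 2 ^ n" for u
      proof -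
        have x: "\<bar>?x s u\<bar> \<le> ?D"
          using even_increment[OF st(1) order_trans[OF st(2,3)] u] mult_left_le[OF D(3), of ?D] D(1) by linarith
        have y': "\<bar>?y t' u\<bar> \<le> ?D"
          using increment[OF ST'(3,4) u] mult_left_le[OF D(3), of ?D] D(1) by linarith
        have "2 * (u div 2) \<le> 2 ^ n" "u \<le> 2 ^ n" "Suc u \<le> 2 ^ n"
          using u by auto
        then have dx: "\<bar>?x s u - ?x s' u\<bar> \<le> 2 * (?D * holder_ratio ^ (5 * n))"
          and dy: "\<bar>?y t u - ?y t' u\<bar> \<le> 2 * (?D * holder_ratio ^ (5 * n))"
          using near(1)[of u] near(1)[of "2 * (u div 2)"] near(2)[of u] near(2)[of "Suc u"] by linarith+
        have "?x s u * ?y t u - ?x s' u * ?y t' u = ?x s u * (?y t u - ?y t' u) + ?y t' u * (?x s u - ?x s' u)"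
          by (simp only: left_diff_distrib right_diff_distrib) simp
        then have "\<bar>?x s u * ?y t u - ?x s' u * ?y t' u\<bar> \<le> \<bar>?x s u\<bar> * \<bar>?y t u - ?y t' u\<bar> + \<bar>?y t' u\<bar> * \<bar>?x s u - ?x s' u\<bar>"
          unfolding abs_mult[symmetric] by (simp only: abs_triangle_ineq)
        also have "\<dots> \<le> ?D * (2 * (?D * holder_ratio ^ (5 * n))) + ?D * (2 * (?D * holder_ratio ^ (5 * n)))"
          using x y' dx dy D by (intro add_mono mult_mono) auto
        finally show ?thesis
          by (simp add: power2_eq_square mult_ac)
      qed
      have "\<bar>?lag s t - ?lag s' t'\<bar> = \<bar>\<Sum>u<2 ^ n. ?x s u * ?y t u - ?x s' u * ?y t' u\<bar>"
        by (simp only: lagged_sum_def sum_subtractf)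
      also have "\<dots> \<le> (\<Sum>u<2 ^ n. \<bar>?x s u * ?y t u - ?x s' u * ?y t' u\<bar>)"
        by (rule sum_abs)
      also have "\<dots> \<le> (\<Sum>u<2 ^ n :: nat. 4 * ?D\<^sup>2 * holder_ratio ^ (5 * n))"
        using termwise by (intro sum_mono) simp
      also have "\<dots> = 4 * ?D\<^sup>2 * (2 ^ n * holder_ratio ^ (5 * n))"
        by simp
      also have "2 ^ n * holder_ratio ^ (5 * n) = holder_ratio ^ n"
      proof -
        have "2 ^ n * holder_ratio ^ (5 * n) = (2 * holder_ratio ^ 4) ^ n * holder_ratio ^ n"
          by (simp add: power_mult_distrib flip: power_mult power_add)
        then show ?thesis by (simp add: holder_ratio_power4)
      qed
      finally show "\<bar>?lag s t\<bar> \<le> real (Suc n) * ?D * holder_ratio ^ n + 4 * ?D\<^sup>2 * holder_ratio ^ n"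
        using grid by linarith
    qed
  qed
qed

text \<open>The Ito sums are continuous in \<open>(s, t)\<close> and their successive differences have summable uniform
  bounds.\<close>

lemma uniform_ito_limit:
  obtains J where "continuous_on closed_triangle J"
    and "\<And>p. p \<in> closed_triangle \<Longrightarrow> (\<lambda>n. ito_sum f n p) \<longlonglongrightarrow> J p"
proof -
  let ?\<Delta> = "\<lambda>n p. ito_sum f (Suc n) p - ito_sum f n p"
  let ?b = "\<lambda>n. real (Suc n) * holder_const * holder_ratio ^ n + 4 * holder_const\<^sup>2 * holder_ratio ^ n"
  have "summable ?b"
  proof -
    have "(\<lambda>n. real (Suc n) * holder_const * 2 powr (- real n / 4) + 4 * holder_const\<^sup>2 * 2 powr (- real n / 4))
        \<in> O(\<lambda>n. 1 / real n ^ 2)"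
      using holder_const_pos by real_asymp
    from summable_comparison_test_bigo[OF _ this] show ?thesis
      unfolding holder_ratio_power using inverse_power_summable[of 2, where 'a = real] by (simp add: inverse_eq_divide)
  qed
  then have sum: "summable (\<lambda>n. ?b (Suc n))"
    by (subst summable_Suc_iff)
  have "\<forall>\<^sub>F n in sequentially. \<forall>p\<in>closed_triangle. norm (?\<Delta> n p) \<le> ?b (Suc n)"
    using eventually_compose_filterlim[OF refinement_bound filterlim_Suc]
    by eventually_elim (auto simp: ito_sum_Suc simp del: of_nat_Suc power_Suc)
  then have "uniform_limit closed_triangle (\<lambda>n p. \<Sum>i<n. ?\<Delta> i p) (\<lambda>p. \<Sum>i. ?\<Delta> i p) sequentially"
    using sum by (rule Weierstrass_m_test_ev)
  moreover have "(\<Sum>i<n. ?\<Delta> i p) = ito_sum f n p - ito_sum f 0 p" for n p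
    by (rule sum_lessThan_telescope)
  ultimately have lim: "uniform_limit closed_triangle (\<lambda>n p. ito_sum f n p - ito_sum f 0 p) (\<lambda>p. \<Sum>i. ?\<Delta> i p) sequentially"
    by simp
  have ito_cont: "continuous_on closed_triangle (ito_sum f n)" for n
  proof -
    have shift: "continuous_on closed_triangle (\<lambda>p. f (g p - 1 + real u / 2 ^ n))"
      if "u \<le> 2 ^ n" "continuous_on closed_triangle g" "\<And>p. p \<in> closed_triangle \<Longrightarrow> g p \<in> {0..1}" for u g
      by (rule continuous_on_compose2[OF continuous])
         (use that unit_shift_in_range[OF _ _ that(1)] in \<open>auto intro!: continuous_intros simp: image_subset_iff\<close>)
    show ?thesis
      unfolding ito_sum_def case_prod_beta
      by (intro continuous_on_sum continuous_on_mult continuous_on_diff shift continuous_on_fst continuous_on_snd continuous_on_id)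
         (auto simp: closed_triangle_def)
  qed
  have "continuous_on closed_triangle (\<lambda>p. \<Sum>i. ?\<Delta> i p)"
    by (rule uniform_limit_theorem[OF _ lim]) (auto intro!: always_eventually continuous_on_diff continuous_on_const ito_cont)
  then have "continuous_on closed_triangle (\<lambda>p. (\<Sum>i. ?\<Delta> i p) + ito_sum f 0 p)"
    by (intro continuous_on_add ito_cont)
  moreover have "(\<lambda>n. ito_sum f n p) \<longlonglongrightarrow> (\<Sum>i. ?\<Delta> i p) + ito_sum f 0 p" if "p \<in> closed_triangle" for p
    using tendsto_add[OF tendsto_uniform_limitI[OF lim that] tendsto_const[of "ito_sum f 0 p"]] by simp
  ultimately show ?thesis
    using that by blast
qed

end

section \<open>The limit of the polygonal areas\<close>

lemma closed_triangle_compact: "compact closed_triangle"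
proof -
  have "closed_triangle = {p. 0 \<le> fst p} \<inter> {p. fst p \<le> snd p} \<inter> {p. snd p \<le> 1}"
    by (auto simp: closed_triangle_def)
  moreover have "closed ({p :: real \<times> real. 0 \<le> fst p} \<inter> {p. fst p \<le> snd p} \<inter> {p. snd p \<le> 1})"
    by (intro closed_Int closed_Collect_le continuous_intros)
  ultimately have "closed closed_triangle"
    by simp
  moreover have "bounded closed_triangle"
    by (rule bounded_subset[of "cbox (0, 0) (1, 1)"]) (auto simp: closed_triangle_def)
  ultimately show ?thesis
    by (simp add: compact_eq_bounded_closed)
qed

lemma upper_subset_closed_triangle: "upper_triangle \<subseteq> closed_triangle"
  by (auto simp: upper_triangle_def closed_triangle_def)

lemma dyadic_square_common_denominator:
  assumes "(s, t) \<in> dyadic_square"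
  obtains S T k where "s = real S / 2 ^ k" "t = real T / 2 ^ k" "S \<le> 2 ^ k" "T \<le> 2 ^ k"
proof -
  from assms obtain m i n j where st: "s = real m / 2 ^ i" "t = real n / 2 ^ j" and "s \<le> 1" "t \<le> 1"
    unfolding dyadic_square_def dyadics_def by auto
  have "s = real (m * 2 ^ j) / 2 ^ (i + j)" "t = real (n * 2 ^ i) / 2 ^ (i + j)"
    by (simp_all add: st power_add)
  moreover from this \<open>s \<le> 1\<close> \<open>t \<le> 1\<close> have "real (m * 2 ^ j) \<le> real (2 ^ (i + j))" "real (n * 2 ^ i) \<le> real (2 ^ (i + j))"
    by (simp_all add: divide_le_eq)
  then have "m * 2 ^ j \<le> 2 ^ (i + j)" "n * 2 ^ i \<le> 2 ^ (i + j)"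
    by (simp_all only: of_nat_le_iff)
  ultimately show ?thesis
    using that by blast
qed

lemma dyadic_approximants:
  fixes x :: real
  assumes "0 \<le> x" "x \<le> 1"
  obtains d where "d \<longlonglongrightarrow> x" "\<And>n :: nat. d n \<in> dyadics \<inter> {0..1}"
proof
  let ?d = "\<lambda>n. dyadic_floor n (x - 1) + 1"
  show "?d \<longlonglongrightarrow> x"
    using tendsto_add[OF dyadic_floor_tendsto[of "x - 1"] tendsto_const[of 1]] assms by simp
  fix n
  have "?d n \<in> dyadics"
    unfolding dyadic_floor_def dyadics_def by auto
  then show "?d n \<in> dyadics \<inter> {0..1}"
    using dyadic_floor_bounds(1)[of "x - 1" n] dyadic_floor_ge[of n "x - 1"] assms by auto
qed

lemma polygonal_levy_area_swap: "polygonal_levy_area X n (s, t) = - polygonal_levy_area X n (t, s)"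
  unfolding polygonal_levy_area_def prod.case
  by (simp add: sum_negf[symmetric] del: sum_negf)

lemma polygonal_levy_area_diagonal: "polygonal_levy_area X n (s, s) = 0"
  by (simp add: polygonal_levy_area_def)

context typical_path
begin

text \<open>On the diagonal the polygonal area vanishes, while half the quadratic variation, which is absent
  in the limit for \<open>s < t\<close>, contributes \<open>1 / 2\<close>. So the continuous function \<open>G\<close> formed by the
  other two terms equals \<open>- 1 / 2\<close> there.\<close>

lemma levy_limit:
  obtains G where "continuous_on closed_triangle G"
    and "\<And>s t. (s, t) \<in> dyadic_square \<Longrightarrow> s < t \<Longrightarrow>
      (\<lambda>n. polygonal_levy_area (segment_process f) n (s, t)) \<longlonglongrightarrow> G (s, t)"
    and "\<And>r. 0 \<le> r \<Longrightarrow> r \<le> 1 \<Longrightarrow> G (r, r) = - 1 / 2"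
proof -
  obtain J where J_cont: "continuous_on closed_triangle J"
    and J: "\<And>p. p \<in> closed_triangle \<Longrightarrow> (\<lambda>n. ito_sum f n p) \<longlonglongrightarrow> J p"
    by (rule uniform_ito_limit) blast
  define G where "G p = J p + 1 / 2 * boundary_term f p" for p
  have path_cont: "continuous_on closed_triangle (\<lambda>p. f (g p))"
    if "continuous_on closed_triangle g" "\<And>p. p \<in> closed_triangle \<Longrightarrow> g p \<in> {-1..1}" for g
    by (rule continuous_on_compose2[OF continuous]) (use that in auto)
  have "continuous_on closed_triangle (boundary_term f)"
    unfolding boundary_term_def case_prod_beta
    by (intro continuous_on_mult continuous_on_diff path_cont continuous_on_fst continuous_on_snd continuous_on_id continuous_on_const)
       (auto simp: closed_triangle_def)
  with J_cont have G_cont: "continuous_on closed_triangle G"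
    unfolding G_def by (intro continuous_intros)
  have off: "(\<lambda>n. polygonal_levy_area (segment_process f) n (s, t)) \<longlonglongrightarrow> G (s, t)"
    if st: "(s, t) \<in> dyadic_square" "s < t" for s t
  proof -
    obtain S T k where ST: "s = real S / 2 ^ k" "t = real T / 2 ^ k" "T \<le> 2 ^ k"
      using st(1) by (elim dyadic_square_common_denominator)
    with st(2) have "S < T"
      by (simp add: divide_less_cancel)
    have tri: "(s, t) \<in> closed_triangle" and s: "0 \<le> s" "s \<le> 1"
      using st by (auto simp: closed_triangle_def dyadic_square_def)
    have "\<forall>\<^sub>F n in sequentially. norm (lagged_sum f n Suc (\<lambda>u. u) s t) \<le> real (Suc n) * holder_const * holder_ratio ^ n"
      using off_diagonal[OF \<open>S < T\<close> ST(3)] modulus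
    proof eventually_elim
      case (elim n)
      have "\<bar>f (s - 1 + real (Suc u) / 2 ^ n) - f (s - 1 + real u / 2 ^ n)\<bar> \<le> holder_const * holder_ratio ^ n"
        if "u < 2 ^ n" for u
      proof -
        have "s - 1 + real (Suc u) / 2 ^ n = s - 1 + real u / 2 ^ n + 1 / 2 ^ n"
          by (simp add: add_divide_distrib)
        then show ?thesis
          using elim(2) unit_shift_in_range[OF s, of u n] unit_shift_in_range[OF s, of "Suc u" n] that
          by (metis Suc_leI atLeastAtMost_iff less_imp_le)
      qed
      with elim(1) show ?case
        unfolding ST(1,2) real_norm_def by (auto intro: less_imp_le)
    qed
    moreover have "(\<lambda>n. real (Suc n) * holder_const * holder_ratio ^ n) \<longlonglongrightarrow> 0"
      unfolding holder_ratio_power using holder_const_pos by real_asymp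
    ultimately have "(\<lambda>n. lagged_sum f n Suc (\<lambda>u. u) s t) \<longlonglongrightarrow> 0"
      by (rule Lim_null_comparison)
    from tendsto_add[OF tendsto_add[OF J[OF tri] tendsto_mult_left[OF this, of "1 / 2"]]
        tendsto_const[of "1 / 2 * boundary_term f (s, t)"]]
    show ?thesis
      unfolding polygonal_levy_area_eq_ito_sum G_def by simp
  qed
  have dyadic_diagonal: "G (r, r) = - 1 / 2" if r: "r \<in> dyadics \<inter> {0..1}" for r
  proof -
    have "(r, r) \<in> dyadic_square"
      using r by (simp add: dyadic_square_def)
    then obtain S k where S: "r = real S / 2 ^ k" "S \<le> 2 ^ k"
      by (elim dyadic_square_common_denominator)
    have "(r, r) \<in> closed_triangle"
      using r by (simp add: closed_triangle_def)
    from tendsto_add[OF tendsto_add[OF J[OF this] tendsto_mult_left[OF quadratic_variation[OF S(2)], of "1 / 2"]]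
        tendsto_const[of "1 / 2 * boundary_term f (r, r)"]]
    have "(\<lambda>n. polygonal_levy_area (segment_process f) n (r, r)) \<longlonglongrightarrow> G (r, r) + 1 / 2"
      unfolding polygonal_levy_area_eq_ito_sum G_def S(1)[symmetric] by (simp add: algebra_simps)
    then have "(\<lambda>n. 0) \<longlonglongrightarrow> G (r, r) + 1 / 2"
      by (simp add: polygonal_levy_area_diagonal)
    then show ?thesis
      by (simp add: LIMSEQ_const_iff)
  qed
  have "G (r, r) = - 1 / 2" if r: "0 \<le> r" "r \<le> 1" for r
  proof -
    obtain d where d: "d \<longlonglongrightarrow> r" "\<And>n :: nat. d n \<in> dyadics \<inter> {0..1}"
      using dyadic_approximants[OF r] by blast
    have "(\<lambda>n. G (d n, d n)) \<longlonglongrightarrow> G (r, r)"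
      by (rule continuous_on_tendsto_compose[OF G_cont tendsto_Pair[OF d(1) d(1)]])
         (use d(2) r in \<open>auto simp: closed_triangle_def\<close>)
    then show ?thesis
      using d(2) by (simp add: dyadic_diagonal LIMSEQ_const_iff)
  qed
  with G_cont off show ?thesis
    using that by blast
qed

end

section \<open>Kernels of the injective tensor product\<close>

text \<open>Kernels of finite sums of elementary tensors are continuous. As evaluation functionals have norm
  at most \<open>1\<close>, convergence of operators in norm implies uniform convergence of their kernels.\<close>

lemma tensor_kernel_continuous:
  assumes "\<Phi> \<in> injective_tensor_product"
  shows "continuous_on ({0..1} \<times> {0..1}) (tensor_kernel \<Phi>)"
proof -
  have dist_unit: "dist (unit_of_real x) (unit_of_real y) = dist x y" if "x \<in> {0..1}" "y \<in> {0..1}" for x y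
    using that by (simp add: dist_unit_interval_def unit_of_real_inverse)
  have unit_cont: "continuous_on {0..1} unit_of_real"
    unfolding continuous_on_iff using dist_unit by metis
  have span: "continuous_on ({0..1} \<times> {0..1}) (tensor_kernel \<Psi>)" if "\<Psi> \<in> span {rank_one x y | x y. True}" for \<Psi>
    using that
  proof (induction rule: span_induct_alt)
    case base
    then show ?case
      by (simp add: tensor_kernel_def case_prod_beta)
  next
    case (step c \<Psi>\<^sub>1 \<Psi>\<^sub>2)
    then obtain g h where \<Psi>\<^sub>1: "\<Psi>\<^sub>1 = rank_one g h"
      by blast
    have "tensor_kernel (c *\<^sub>R \<Psi>\<^sub>1 + \<Psi>\<^sub>2) p = c * (apply_bcontfun g (unit_of_real (fst p)) * apply_bcontfun h (unit_of_real (snd p)))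
        + tensor_kernel \<Psi>\<^sub>2 p" for p
      using tensor_kernel_rank_one[of g h "fst p" "snd p"]
      by (simp add: \<Psi>\<^sub>1 tensor_kernel_def case_prod_beta blinfun.add_left blinfun.scaleR_left
          plus_bcontfun.rep_eq scaleR_bcontfun.rep_eq)
    moreover have coordinate: "continuous_on ({0..1} \<times> {0..1}) (\<lambda>p. apply_bcontfun k (unit_of_real (j p)))"
      if "continuous_on ({0..1} \<times> {0..1}) j" "\<And>p. p \<in> {0..1} \<times> {0..1} \<Longrightarrow> j p \<in> {0..1}"
      for k and j :: "real \<times> real \<Rightarrow> real"
    proof -
      have "continuous_on ({0..1} \<times> {0..1}) (\<lambda>p. unit_of_real (j p))"
        by (rule continuous_on_compose2[OF unit_cont that(1)]) (use that(2) in auto)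
      moreover have "continuous_on UNIV (apply_bcontfun k)"
        using apply_bcontfun[of k] by (simp add: bcontfun_def)
      ultimately show ?thesis
        by (auto intro: continuous_on_compose2)
    qed
    ultimately show ?case
      using step.IH
      by (simp only:) (intro continuous_on_add continuous_on_mult continuous_on_const coordinate
          continuous_on_fst continuous_on_snd continuous_on_id; auto)
  qed
  have kernel_le: "\<bar>tensor_kernel \<Phi> p - tensor_kernel \<Psi> p\<bar> \<le> norm (\<Phi> - \<Psi>)" for \<Psi> p
  proof -
    obtain s t where p: "p = (s, t)"
      by (cases p)
    let ?ev = "eval_functional (unit_of_real s)"
    have ev: "norm ?ev \<le> 1"
      by (rule norm_blinfun_bound) (simp_all only: eval_functional.rep_eq mult_1 norm_bounded zero_le_one)
    have "\<bar>tensor_kernel \<Phi> p - tensor_kernel \<Psi> p\<bar>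
        = norm (apply_bcontfun (blinfun_apply (\<Phi> - \<Psi>) ?ev) (unit_of_real t))"
      by (simp add: p tensor_kernel_def blinfun.diff_left minus_bcontfun.rep_eq)
    also have "\<dots> \<le> norm (blinfun_apply (\<Phi> - \<Psi>) ?ev)"
      by (rule norm_bounded)
    also have "\<dots> \<le> norm (\<Phi> - \<Psi>) * norm ?ev"
      by (rule norm_blinfun)
    also have "\<dots> \<le> norm (\<Phi> - \<Psi>)"
      using mult_left_mono[OF ev, of "norm (\<Phi> - \<Psi>)"] by simp
    finally show ?thesis .
  qed
  obtain \<Psi> where \<Psi>: "\<And>n. \<Psi> n \<in> span {rank_one x y | x y. True}" "\<Psi> \<longlonglongrightarrow> \<Phi>"
    using assms unfolding injective_tensor_product_def closure_sequential by blast
  have "uniform_limit ({0..1} \<times> {0..1}) (\<lambda>n. tensor_kernel (\<Psi> n)) (tensor_kernel \<Phi>) sequentially"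
  proof (rule uniform_limitI)
    fix e :: real assume "0 < e"
    with \<Psi>(2) have "\<forall>\<^sub>F n in sequentially. dist (\<Psi> n) \<Phi> < e"
      by (rule tendstoD)
    then show "\<forall>\<^sub>F n in sequentially. \<forall>p\<in>{0..1} \<times> {0..1}. dist (tensor_kernel (\<Psi> n) p) (tensor_kernel \<Phi> p) < e"
    proof eventually_elim
      case (elim n)
      then have "norm (\<Phi> - \<Psi> n) < e"
        by (simp add: dist_norm norm_minus_commute)
      then show ?case
        using kernel_le[of _ "\<Psi> n"] by (auto simp: dist_real_def abs_minus_commute intro: le_less_trans)
    qed
  qed
  then show ?thesis
    using span[OF \<Psi>(1)] by (intro uniform_limit_theorem[where f = "\<lambda>n. tensor_kernel (\<Psi> n)" and F = sequentially]) auto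
qed

section \<open>The extension and its jump on the diagonal\<close>

context typical_path
begin

lemma polygonal_levy_area_convergent:
  assumes "p \<in> dyadic_square"
  shows "convergent (\<lambda>n. polygonal_levy_area (segment_process f) n p)"
proof -
  obtain G where G: "\<And>s t. (s, t) \<in> dyadic_square \<Longrightarrow> s < t \<Longrightarrow>
      (\<lambda>n. polygonal_levy_area (segment_process f) n (s, t)) \<longlonglongrightarrow> G (s, t)"
    by (rule levy_limit) blast
  obtain s t where p: "p = (s, t)"
    by (cases p)
  consider "s < t" | "s = t" | "t < s"
    by linarith
  then show ?thesis
  proof cases
    case 1
    then show ?thesis
      using G assms by (auto simp: p convergent_def)
  next
    case 2
    then show ?thesis
      by (simp add: p polygonal_levy_area_diagonal convergent_const)
  next
    case 3
    have "(t, s) \<in> dyadic_square"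
      using assms by (auto simp: p dyadic_square_def)
    from tendsto_minus[OF G[OF this 3]] show ?thesis
      unfolding p polygonal_levy_area_swap[of _ _ s t] convergent_def by blast
  qed
qed

text \<open>The function \<open>G\<close> of \<open>levy_limit\<close>, reflected antisymmetrically, is the extension \<open>A\<close>: it is uniformly
  continuous as the closed triangle is compact, and unique as the dyadic points are dense. A
  continuous kernel or a continuous extension to the square would have a single limit at
  \<open>(1 / 2, 1 / 2)\<close>, where \<open>A\<close> has the limits \<open>- 1 / 2\<close> and \<open>1 / 2\<close> and the area is \<open>0\<close>.\<close>

lemma levy_area_properties:
  shows "\<exists>A :: real \<times> real \<Rightarrow> real.
        uniformly_continuous_extension (dyadic_square \<inter> upper_triangle) upper_triangle
          (levy_area (segment_process f)) A \<and>
        (\<forall>A'. uniformly_continuous_extension (dyadic_square \<inter> upper_triangle) upper_triangle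
            (levy_area (segment_process f)) A' \<longrightarrow> (\<forall>p\<in>upper_triangle. A' p = A p)) \<and>
        (\<forall>(s, t)\<in>lower_triangle. A (s, t) = - A (t, s)) \<and>
        (\<forall>p\<in>dyadic_square \<inter> (upper_triangle \<union> lower_triangle).
            A p = levy_area (segment_process f) p) \<and>
        jump_on_diagonal A \<and>
        \<not> (\<exists>\<Phi> \<in> injective_tensor_product. \<forall>p\<in>upper_triangle \<union> lower_triangle.
            tensor_kernel \<Phi> p = A p)" (is ?extension)
    and "\<not> (\<exists>G :: real \<times> real \<Rightarrow> real. continuous_on ({0..1} \<times> {0..1}) G \<and>
          (\<forall>p\<in>dyadic_square. G p = levy_area (segment_process f) p))" (is ?no_extension)
proof -
  obtain G where G_cont: "continuous_on closed_triangle G"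
    and G_lim: "\<And>s t. (s, t) \<in> dyadic_square \<Longrightarrow> s < t \<Longrightarrow>
      (\<lambda>n. polygonal_levy_area (segment_process f) n (s, t)) \<longlonglongrightarrow> G (s, t)"
    and G_diag: "\<And>r. 0 \<le> r \<Longrightarrow> r \<le> 1 \<Longrightarrow> G (r, r) = - 1 / 2"
    by (rule levy_limit) blast
  let ?L = "levy_area (segment_process f)"
  define A where "A = (\<lambda>(s, t). if s \<le> t then G (s, t) else - G (t, s))"
  have A_upper: "A p = G p" if "p \<in> closed_triangle" for p
    using that by (auto simp: A_def closed_triangle_def)
  have A_lower: "A p = - G (prod.swap p)" if "p \<in> lower_triangle" for p
    using that by (auto simp: A_def lower_triangle_def)
  have L_upper: "?L p = G p" if "p \<in> dyadic_square \<inter> upper_triangle" for p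
    using that G_lim by (cases p) (auto simp: levy_area_def upper_triangle_def intro!: limI)
  have L_lower: "?L p = A p" if "p \<in> dyadic_square \<inter> lower_triangle" for p
  proof -
    obtain s t where p: "p = (s, t)"
      by (cases p)
    have "(t, s) \<in> dyadic_square" "t < s"
      using that by (auto simp: p dyadic_square_def lower_triangle_def)
    from tendsto_minus[OF G_lim[OF this]]
    have "(\<lambda>n. polygonal_levy_area (segment_process f) n p) \<longlonglongrightarrow> - G (t, s)"
      unfolding p polygonal_levy_area_swap[of _ _ s t] .
    then show ?thesis
      using \<open>t < s\<close> by (simp add: levy_area_def A_def p limI)
  qed
  have A_L: "A p = ?L p" if "p \<in> dyadic_square \<inter> upper_triangle" for p
    using A_upper[of p] L_upper[OF that] that upper_subset_closed_triangle by auto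
  have "uniformly_continuous_on closed_triangle G"
    by (rule compact_uniformly_continuous[OF G_cont closed_triangle_compact])
  then have A_unif: "uniformly_continuous_on upper_triangle A"
    using A_upper upper_subset_closed_triangle unfolding uniformly_continuous_on_def by (metis subsetD)
  have A_ext: "uniformly_continuous_extension (dyadic_square \<inter> upper_triangle) upper_triangle ?L A"
    using A_unif A_L by (simp add: uniformly_continuous_extension_def)
  have unique: "A' p = A p"
    if A': "uniformly_continuous_extension (dyadic_square \<inter> upper_triangle) upper_triangle ?L A'"
      and p: "p \<in> upper_triangle" for A' p
  proof -
    obtain s t where st: "p = (s, t)" "0 \<le> s" "s < t" "t \<le> 1"
      using p by (auto simp: upper_triangle_def)
    obtain d e where d: "d \<longlonglongrightarrow> s" "\<And>n :: nat. d n \<in> dyadics \<inter> {0..1}"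
      and e: "e \<longlonglongrightarrow> t" "\<And>n :: nat. e n \<in> dyadics \<inter> {0..1}"
      using dyadic_approximants[of s] dyadic_approximants[of t] st by (metis less_imp_le order_trans)
    have "\<forall>\<^sub>F n in sequentially. d n < e n"
    proof -
      obtain c where c: "s < c" "c < t"
        using dense[OF st(3)] by blast
      show ?thesis
        using order_tendstoD(2)[OF d(1) c(1)] order_tendstoD(1)[OF e(1) c(2)]
        by eventually_elim simp
    qed
    then have in_dense: "\<forall>\<^sub>F n in sequentially. (d n, e n) \<in> dyadic_square \<inter> upper_triangle"
      using d(2) e(2) by (auto elim!: eventually_mono simp: dyadic_square_def upper_triangle_def)
    have conv: "(\<lambda>n. H (d n, e n)) \<longlonglongrightarrow> H p" if "uniformly_continuous_on upper_triangle H" for H :: "real \<times> real \<Rightarrow> real"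
      unfolding st(1)
      by (rule continuous_on_tendsto_compose[OF uniformly_continuous_imp_continuous[OF that] tendsto_Pair[OF d(1) e(1)]])
         (use p st(1) in_dense in \<open>auto elim: eventually_mono\<close>)
    have "\<forall>\<^sub>F n in sequentially. A' (d n, e n) = A (d n, e n)"
      using in_dense by eventually_elim (use A' A_L in \<open>auto simp: uniformly_continuous_extension_def\<close>)
    then have "(\<lambda>n. A (d n, e n)) \<longlonglongrightarrow> A' p"
      using conv[of A'] A' by (auto simp: uniformly_continuous_extension_def intro: Lim_transform_eventually)
    then show ?thesis
      using conv[OF A_unif] by (rule LIMSEQ_unique)
  qed
  have jump: "jump_on_diagonal A"
    unfolding jump_on_diagonal_def
  proof (intro ballI exI conjI)
    fix r :: real assume r: "r \<in> {0..1}"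
    have "(r, r) \<in> closed_triangle"
      using r by (simp add: closed_triangle_def)
    then have "(G \<longlongrightarrow> G (r, r)) (at (r, r) within closed_triangle)"
      using G_cont unfolding continuous_on_def by blast
    then have "(G \<longlongrightarrow> - 1 / 2) (at (r, r) within closed_triangle)"
      using r G_diag[of r] by simp
    then have G_up: "(G \<longlongrightarrow> - 1 / 2) (at (r, r) within upper_triangle)"
      by (rule tendsto_within_subset[OF _ upper_subset_closed_triangle])
    have "\<forall>\<^sub>F p in at (r, r) within upper_triangle. G p = A p"
      unfolding eventually_at_filter using A_upper upper_subset_closed_triangle
      by (intro always_eventually) (metis subsetD)
    then show "(A \<longlongrightarrow> - 1 / 2) (at (r, r) within upper_triangle)"
      by (rule Lim_transform_eventually[OF G_up])
    \<comment> \<open>below the diagonal \<open>A\<close> is the reflection of \<open>- G\<close>\<close>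
    let ?K = "prod.swap -` closed_triangle :: (real \<times> real) set"
    have "continuous_on ?K (\<lambda>p. - G (prod.swap p))"
      by (intro continuous_on_minus continuous_on_compose2[OF G_cont] continuous_on_swap) auto
    moreover have "(r, r) \<in> ?K"
      using r by (simp add: closed_triangle_def)
    ultimately have "((\<lambda>p. - G (prod.swap p)) \<longlongrightarrow> - G (prod.swap (r, r))) (at (r, r) within ?K)"
      unfolding continuous_on_def by blast
    then have "((\<lambda>p. - G (prod.swap p)) \<longlongrightarrow> 1 / 2) (at (r, r) within ?K)"
      using r G_diag[of r] by simp
    then have G_low: "((\<lambda>p. - G (prod.swap p)) \<longlongrightarrow> 1 / 2) (at (r, r) within lower_triangle)"
      by (rule tendsto_within_subset) (auto simp: lower_triangle_def closed_triangle_def)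
    have "\<forall>\<^sub>F p in at (r, r) within lower_triangle. - G (prod.swap p) = A p"
      unfolding eventually_at_filter using A_lower by (intro always_eventually) metis
    then show "(A \<longlongrightarrow> 1 / 2) (at (r, r) within lower_triangle)"
      by (rule Lim_transform_eventually[OF G_low])
  qed simp
  \<comment> \<open>dyadic points that approach the diagonal point \<open>(1 / 2, 1 / 2)\<close> from the upper triangle and, with coordinates exchanged, from the lower one\<close>
  define h where "h n = (1 / 2 :: real) + 1 / 2 ^ (n + 1)" for n :: nat
  have h: "h \<longlonglongrightarrow> 1 / 2" "1 / 2 < h n" "h n \<le> 1" for n
  proof -
    show "h \<longlonglongrightarrow> 1 / 2"
      unfolding h_def by real_asymp
    show "1 / 2 < h n" "h n \<le> 1"
      using one_le_power[of "2 :: real" n] by (auto simp: h_def field_simps)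
  qed
  have h_dyadic: "h n \<in> dyadics" for n
  proof -
    have "h n = real (2 ^ n + 1) / 2 ^ (n + 1)"
      by (simp add: h_def add_divide_distrib)
    then show ?thesis
      unfolding dyadics_def by blast
  qed
  have half: "1 / 2 \<in> (dyadics :: real set)"
    unfolding dyadics_def by (auto intro!: exI[of _ 1])
  have above: "(1 / 2, h n) \<in> dyadic_square \<inter> upper_triangle" for n
    using h(2,3)[of n] half h_dyadic[of n] by (simp add: dyadic_square_def upper_triangle_def)
  have below: "(h n, 1 / 2) \<in> lower_triangle" for n
    using h(2,3)[of n] by (simp add: lower_triangle_def)
  have G_half: "(\<lambda>n. G (1 / 2, h n)) \<longlonglongrightarrow> - 1 / 2"
  proof -
    have "(\<lambda>n. G (1 / 2, h n)) \<longlonglongrightarrow> G (1 / 2, 1 / 2)"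
      by (rule continuous_on_tendsto_compose[OF G_cont tendsto_Pair[OF tendsto_const h(1)]])
         (use h(2,3) in \<open>auto simp: closed_triangle_def less_imp_le intro!: always_eventually\<close>)
    then show ?thesis by (simp add: G_diag)
  qed
  have square_lim: "(\<lambda>n. H (1 / 2, h n)) \<longlonglongrightarrow> H (1 / 2, 1 / 2)" "(\<lambda>n. H (h n, 1 / 2)) \<longlonglongrightarrow> H (1 / 2, 1 / 2)"
    if "continuous_on ({0..1} \<times> {0..1}) H" for H :: "real \<times> real \<Rightarrow> real"
  proof -
    have "h n \<in> {0..1}" for n
      using h(2,3)[of n] by simp
    then show "(\<lambda>n. H (1 / 2, h n)) \<longlonglongrightarrow> H (1 / 2, 1 / 2)" "(\<lambda>n. H (h n, 1 / 2)) \<longlonglongrightarrow> H (1 / 2, 1 / 2)"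
      by (auto intro!: continuous_on_tendsto_compose[OF that] tendsto_Pair tendsto_const h(1) always_eventually)
  qed
  have no_tensor: "\<not> (\<exists>\<Phi> \<in> injective_tensor_product. \<forall>p\<in>upper_triangle \<union> lower_triangle. tensor_kernel \<Phi> p = A p)"
  proof
    assume "\<exists>\<Phi> \<in> injective_tensor_product. \<forall>p\<in>upper_triangle \<union> lower_triangle. tensor_kernel \<Phi> p = A p"
    then obtain \<Phi> where \<Phi>: "\<Phi> \<in> injective_tensor_product"
      "\<And>p. p \<in> upper_triangle \<union> lower_triangle \<Longrightarrow> tensor_kernel \<Phi> p = A p"
      by blast
    have up: "tensor_kernel \<Phi> (1 / 2, h n) = G (1 / 2, h n)" for n
      using \<Phi>(2)[of "(1 / 2, h n)"] A_upper[of "(1 / 2, h n)"] above[of n] upper_subset_closed_triangle by auto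
    have low: "tensor_kernel \<Phi> (h n, 1 / 2) = - G (1 / 2, h n)" for n
      using \<Phi>(2)[of "(h n, 1 / 2)"] A_lower[of "(h n, 1 / 2)"] below[of n] by auto
    have "tensor_kernel \<Phi> (1 / 2, 1 / 2) = - 1 / 2"
      using LIMSEQ_unique[OF square_lim(1)[OF tensor_kernel_continuous[OF \<Phi>(1)]]] G_half by (simp add: up)
    moreover have "tensor_kernel \<Phi> (1 / 2, 1 / 2) = 1 / 2"
      using LIMSEQ_unique[OF square_lim(2)[OF tensor_kernel_continuous[OF \<Phi>(1)]]] tendsto_minus[OF G_half] by (simp add: low)
    ultimately show False by simp
  qed
  show ?extension
  proof (intro exI[of _ A] conjI)
    show "\<forall>A'. uniformly_continuous_extension (dyadic_square \<inter> upper_triangle) upper_triangle ?L A' \<longrightarrow>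
        (\<forall>p\<in>upper_triangle. A' p = A p)"
      using unique by blast
    show "\<forall>(s, t)\<in>lower_triangle. A (s, t) = - A (t, s)"
      by (auto simp: A_def lower_triangle_def)
    show "\<forall>p\<in>dyadic_square \<inter> (upper_triangle \<union> lower_triangle). A p = ?L p"
      using A_L L_lower by (metis IntE IntI UnE)
  qed (fact A_ext jump no_tensor)+
  show ?no_extension
  proof
    assume "\<exists>H :: real \<times> real \<Rightarrow> real. continuous_on ({0..1} \<times> {0..1}) H \<and> (\<forall>p\<in>dyadic_square. H p = ?L p)"
    then obtain H :: "real \<times> real \<Rightarrow> real" where H: "continuous_on ({0..1} \<times> {0..1}) H"
      "\<And>p. p \<in> dyadic_square \<Longrightarrow> H p = ?L p"
      by blast
    \<comment> \<open>at \<open>(1 / 2, 1 / 2)\<close> the limit from above is \<open>- 1 / 2\<close>, but the area itself is \<open>0\<close>\<close>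
    have "H (1 / 2, h n) = G (1 / 2, h n)" for n
      using H(2)[of "(1 / 2, h n)"] L_upper[OF above[of n]] above[of n] by auto
    then have "H (1 / 2, 1 / 2) = - 1 / 2"
      using LIMSEQ_unique[OF square_lim(1)[OF H(1)]] G_half by simp
    moreover have "H (1 / 2, 1 / 2) = ?L (1 / 2, 1 / 2)"
      using half by (intro H(2)) (simp add: dyadic_square_def)
    moreover have "?L (1 / 2, 1 / 2) = 0"
      by (simp add: levy_area_def polygonal_levy_area_diagonal limI)
    ultimately show False by simp
  qed
qed

end

lemma AE_typical_path:
  fixes B :: "real \<Rightarrow> 'a \<Rightarrow> real"
  assumes bm: "brownian_motion M (-1) 1 B"
  shows "AE \<omega> in M. typical_path (\<lambda>t. B t \<omega>)"
proof -
  have "AE \<omega> in M. continuous_on {-1..1} (\<lambda>t. B t \<omega>)"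
    using bm by (simp add: brownian_motion_def)
  moreover have "AE \<omega> in M. \<forall>S T k. S < T \<longrightarrow> T \<le> 2 ^ k \<longrightarrow> (\<forall>\<^sub>F n in sequentially.
      (\<forall>u<2 ^ n. \<bar>B (real S / 2 ^ k - 1 + real (Suc u) / 2 ^ n) \<omega>
          - B (real S / 2 ^ k - 1 + real u / 2 ^ n) \<omega>\<bar> \<le> holder_const * holder_ratio ^ n) \<longrightarrow>
      \<bar>lagged_sum (\<lambda>x. B x \<omega>) n Suc (\<lambda>u. u) (real S / 2 ^ k) (real T / 2 ^ k)\<bar> < real (Suc n) * holder_const * holder_ratio ^ n)"
    unfolding AE_all_countable using AE_lagged_sum_off_diagonal[OF bm] by (simp add: AE_impI)
  moreover have "AE \<omega> in M. \<forall>S k. S \<le> 2 ^ k \<longrightarrow>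
      (\<lambda>n. lagged_sum (\<lambda>x. B x \<omega>) n Suc (\<lambda>u. u) (real S / 2 ^ k) (real S / 2 ^ k)) \<longlonglongrightarrow> 1"
    unfolding AE_all_countable using AE_quadratic_variation[OF bm] by (simp add: AE_impI)
  ultimately show ?thesis
    using AE_small_dyadic_increments[OF bm] AE_lagged_sum_refinement[OF bm]
    by eventually_elim (unfold_locales; blast)
qed

theorem proposition49:
  fixes W :: "(real \<Rightarrow> real) measure"
  assumes "wiener_measure W"
  shows "\<exists>\<Omega>\<^sub>0 \<in> sets (completion W). emeasure (completion W) \<Omega>\<^sub>0 = 1 \<and>
    (\<forall>f\<in>\<Omega>\<^sub>0.
      (\<forall>p\<in>dyadic_square. convergent (\<lambda>n. polygonal_levy_area (segment_process f) n p)) \<and>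
      (\<exists>A :: real \<times> real \<Rightarrow> real.
        uniformly_continuous_extension (dyadic_square \<inter> upper_triangle) upper_triangle
          (levy_area (segment_process f)) A \<and>
        (\<forall>A'. uniformly_continuous_extension (dyadic_square \<inter> upper_triangle) upper_triangle
            (levy_area (segment_process f)) A' \<longrightarrow> (\<forall>p\<in>upper_triangle. A' p = A p)) \<and>
        (\<forall>(s, t)\<in>lower_triangle. A (s, t) = - A (t, s)) \<and>
        (\<forall>p\<in>dyadic_square \<inter> (upper_triangle \<union> lower_triangle).
            A p = levy_area (segment_process f) p) \<and>
        jump_on_diagonal A \<and>
        \<not> (\<exists>\<Phi> \<in> injective_tensor_product. \<forall>p\<in>upper_triangle \<union> lower_triangle.
            tensor_kernel \<Phi> p = A p)) \<and>
      \<not> (\<exists>G :: real \<times> real \<Rightarrow> real. continuous_on ({0..1} \<times> {0..1}) G \<and>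
          (\<forall>p\<in>dyadic_square. G p = levy_area (segment_process f) p)))"
proof -
  have bm: "brownian_motion W (-1) 1 (\<lambda>t f. f t)"
    using assms by (simp add: wiener_measure_def)
  interpret prob_space W
    using bm by (simp add: brownian_motion_def)
  have "AE f in W. typical_path f"
    using AE_typical_path[OF bm] by simp
  then obtain N where N: "{f \<in> space W. \<not> typical_path f} \<subseteq> N" "N \<in> sets W" "emeasure W N = 0"
    by (rule AE_E)
  define \<Omega>\<^sub>0 where "\<Omega>\<^sub>0 = space W - N"
  have sets: "\<Omega>\<^sub>0 \<in> sets W"
    unfolding \<Omega>\<^sub>0_def using N(2) by auto
  have typical: "typical_path f" if "f \<in> \<Omega>\<^sub>0" for f
    using that N(1) by (auto simp: \<Omega>\<^sub>0_def)
  show ?thesis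
  proof (intro bexI[of _ \<Omega>\<^sub>0] conjI ballI)
    have "emeasure W \<Omega>\<^sub>0 = 1"
      unfolding \<Omega>\<^sub>0_def using emeasure_compl[OF N(2)] N(3) emeasure_space_1 by simp
    then show "emeasure (completion W) \<Omega>\<^sub>0 = 1"
      using sets by simp
    show "\<Omega>\<^sub>0 \<in> sets (completion W)"
      using sets by (simp add: sets_completionI_sets)
  next
    fix f p assume "f \<in> \<Omega>\<^sub>0" "p \<in> dyadic_square"
    then show "convergent (\<lambda>n. polygonal_levy_area (segment_process f) n p)"
      by (intro typical_path.polygonal_levy_area_convergent typical)
  next
    fix f assume "f \<in> \<Omega>\<^sub>0"
    note f = typical_path.levy_area_properties[OF typical[OF this]]
    show "\<exists>A :: real \<times> real \<Rightarrow> real.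
        uniformly_continuous_extension (dyadic_square \<inter> upper_triangle) upper_triangle
          (levy_area (segment_process f)) A \<and>
        (\<forall>A'. uniformly_continuous_extension (dyadic_square \<inter> upper_triangle) upper_triangle
            (levy_area (segment_process f)) A' \<longrightarrow> (\<forall>p\<in>upper_triangle. A' p = A p)) \<and>
        (\<forall>(s, t)\<in>lower_triangle. A (s, t) = - A (t, s)) \<and>
        (\<forall>p\<in>dyadic_square \<inter> (upper_triangle \<union> lower_triangle).
            A p = levy_area (segment_process f) p) \<and>
        jump_on_diagonal A \<and>
        \<not> (\<exists>\<Phi> \<in> injective_tensor_product. \<forall>p\<in>upper_triangle \<union> lower_triangle.
            tensor_kernel \<Phi> p = A p)"
      by (rule f(1))
    show "\<not> (\<exists>G :: real \<times> real \<Rightarrow> real. continuous_on ({0..1} \<times> {0..1}) G \<and>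
          (\<forall>p\<in>dyadic_square. G p = levy_area (segment_process f) p))"
      by (rule f(2))
  qed
qed

end
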